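(* Let $N \geq 3$, $p \in (1,N)$, $p^*=\frac{Np}{N-p}$ and $r \in (p,p^*]$. If $g \in \mathcal{H}_{p,r}(\mathbb{R}^N)$, then $$\int_{\mathbb{R}^N} |g|\, |u|^p \log |u|^p \, dx \leq \frac{r}{r-p} \log \left( C_H \, \|g\|_{p,r}^{\frac{p}{r}} \int_{\mathbb{R}^N} |\nabla u|^p \, dx \right)$$ for all $u \in \mathcal{D}^{1,p}_0(\mathbb{R}^N)$ with $\int_{\mathbb{R}^N} |g|\,|u|^p \, dx=1$, where $C_H = p^p (p-1)^{1-p}$.
   Context: $\mathcal{D}^{1,p}_0(\mathbb{R}^N)$ is the Beppo-Levi space: the completion of $C_c^\infty(\mathbb{R}^N)$ with respect to the norm $\left[\int_{\mathbb{R}^N} |\nabla u|^p\,dx\right]^{1/p}$ (for $1<p<N$ its elements are identified with functions in $L^{p^*}(\mathbb{R}^N)$ via the Sobolev inequality). For a relatively compact (measurable) set $F \subset\subset \mathbb{R}^N$, the $p$-capacity is $\mathrm{Cap}_p(F)=\inf\left\{\int_{\mathbb{R}^N} |\nabla u|^p\,dx : u \in \mathcal{D}^{1,p}_0(\mathbb{R}^N),\ u \geq 1 \text{ on } F\right\}$. For $1<p\le r\le p^*$, $$\|g\|_{p,r} = \sup_{F \subset\subset \mathbb{R}^N} \frac{\int_F |g|\,dx}{[\mathrm{Cap}_p(F)]^{r/p}}, \qquad \mathcal{H}_{p,r}(\mathbb{R}^N)=\left\{g \in L^1_{loc}(\mathbb{R}^N): \|g\|_{p,r}<\infty\right\}$$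 (a quotient $0/0$ is read as $0$). The convention $0\log 0=0$ is used, and the integral on the left-hand side is understood as an extended real number (it may equal $-\infty$). *)

theory Defs
  imports "HOL-Analysis.Analysis"
begin

definition partial_deriv :: "'n \<Rightarrow> (real ^ 'n \<Rightarrow> real) \<Rightarrow> real ^ 'n \<Rightarrow> real" where
  "partial_deriv i f x = frechet_derivative f (at x) (axis i 1)"

definition grad :: "(real ^ 'n \<Rightarrow> real) \<Rightarrow> real ^ 'n \<Rightarrow> real ^ 'n" where
  "grad f x = (\<chi> i. partial_deriv i f x)"

primrec Ck :: "nat \<Rightarrow> (real ^ 'n \<Rightarrow> real) \<Rightarrow> bool" where
  "Ck 0 f \<longleftrightarrow> continuous_on UNIV f"
| "Ck (Suc k) f \<longleftrightarrow> (\<forall>x. f differentiable (at x)) \<and> (\<forall>i. Ck k (partial_deriv i f))"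

definition test_functions :: "(real ^ 'n \<Rightarrow> real) set" where
  "test_functions = {f. (\<forall>k. Ck k f) \<and> compact (closure {x. f x \<noteq> 0})}"

definition locally_integrable :: "(real ^ 'n \<Rightarrow> 'b::euclidean_space) \<Rightarrow> bool" where
  "locally_integrable f \<longleftrightarrow> f \<in> borel_measurable lebesgue \<and> (\<forall>K. compact K \<longrightarrow> f absolutely_integrable_on K)"

definition is_weak_grad :: "(real ^ 'n \<Rightarrow> real) \<Rightarrow> (real ^ 'n \<Rightarrow> real ^ 'n) \<Rightarrow> bool" where
  "is_weak_grad u G \<longleftrightarrow> locally_integrable u \<and> locally_integrable G \<and>
     (\<forall>\<phi>\<in>test_functions. \<forall>i.
        (LINT x|lebesgue. u x * partial_deriv i \<phi> x) = - (LINT x|lebesgue. G x $ i * \<phi> x))"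

text \<open>A weak gradient is unique up to a null set, so the choice below does not affect
  any integral. Every element of the Beppo-Levi space has one.\<close>

definition weak_grad :: "(real ^ 'n \<Rightarrow> real) \<Rightarrow> real ^ 'n \<Rightarrow> real ^ 'n" where
  "weak_grad u = (SOME G. is_weak_grad u G)"

definition grad_norm :: "real \<Rightarrow> (real ^ 'n \<Rightarrow> real) \<Rightarrow> real" where
  "grad_norm p \<phi> = (LINT x|lebesgue. norm (grad \<phi> x) powr p) powr (1 / p)"

definition sobolev_exponent :: "nat \<Rightarrow> real \<Rightarrow> real" where
  "sobolev_exponent N p = real N * p / (real N - p)"

text \<open>The completion of the test functions under \<^const>\<open>grad_norm\<close>, for \<open>1 < p < N\<close>. By the
  Sobolev inequality, a Cauchy sequence of test functions converges in \<open>L\<close> with the Sobolev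
  exponent; the element of the completion that it represents is identified with this limit. The
  set consists of functions rather than classes and is closed under changes on null sets.\<close>

definition beppo_levi :: "real \<Rightarrow> (real ^ 'n \<Rightarrow> real) set" where
  "beppo_levi p = {u. u \<in> borel_measurable lebesgue \<and>
     (\<exists>\<phi>. (\<forall>k. \<phi> k \<in> test_functions) \<and>
        (\<forall>e>0. \<exists>K. \<forall>m\<ge>K. \<forall>n\<ge>K. grad_norm p (\<lambda>x. \<phi> m x - \<phi> n x) < e) \<and>
        (\<lambda>k. \<integral>\<^sup>+ x. ennreal (\<bar>\<phi> k x - u x\<bar> powr sobolev_exponent CARD('n) p) \<partial>lebesgue)
          \<longlonglongrightarrow> 0)}"

definition dirichlet :: "real \<Rightarrow> (real ^ 'n \<Rightarrow> real) \<Rightarrow> real" where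
  "dirichlet p u = (LINT x|lebesgue. norm (weak_grad u x) powr p)"

text \<open>The constraint \<open>u \<ge> 1\<close> on \<open>F\<close> is imposed almost everywhere, as elements of the space are
  determined only up to null sets. For bounded \<open>F\<close> the infimum is over a nonempty set of
  nonnegative reals, because some test function equals 1 on \<open>F\<close>.\<close>

definition capacity :: "real \<Rightarrow> (real ^ 'n) set \<Rightarrow> real" where
  "capacity p F =
     (INF u\<in>{u \<in> beppo_levi p. AE x in lebesgue. x \<in> F \<longrightarrow> 1 \<le> u x}. dirichlet p u)"

text \<open>In \<^typ>\<open>ennreal\<close> we have \<open>0 / 0 = 0\<close> and \<open>c / 0 = \<infinity>\<close> for \<open>c > 0\<close>, as required here.\<close>

definition H_norm :: "real \<Rightarrow> real \<Rightarrow> (real ^ 'n \<Rightarrow> real) \<Rightarrow> ennreal" where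
  "H_norm p r g = (SUP F\<in>{F. F \<in> sets lebesgue \<and> compact (closure F)}.
     (\<integral>\<^sup>+ x\<in>F. ennreal \<bar>g x\<bar> \<partial>lebesgue) / ennreal (capacity p F powr (r / p)))"

definition H_space :: "real \<Rightarrow> real \<Rightarrow> (real ^ 'n \<Rightarrow> real) set" where
  "H_space p r = {g. locally_integrable g \<and> H_norm p r g < \<infinity>}"

text \<open>Integral with values in the extended reals. Since \<open>\<infinity> - \<infinity> = \<infinity>\<close> in \<^typ>\<open>ereal\<close>, a real
  upper bound on it implies that the positive part has a finite integral, so that the integral is
  well defined.\<close>

definition ext_integral :: "'a measure \<Rightarrow> ('a \<Rightarrow> real) \<Rightarrow> ereal" where
  "ext_integral M f =
     enn2ereal (\<integral>\<^sup>+ x. ennreal (f x) \<partial>M) - enn2ereal (\<integral>\<^sup>+ x. ennreal (- f x) \<partial>M)"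

definition C_H :: "real \<Rightarrow> real" where
  "C_H p = p powr p * (p - 1) powr (1 - p)"

end

theory Submission
  imports Defs
begin

text \<open>
Write \<open>D\<close> for the energy of \<open>u\<close>, \<open>H\<close> for the norm of \<open>g\<close> and \<open>I\<close> for the integral of
\<open>\<bar>g\<bar> * \<bar>u\<bar> powr r\<close>. The measure with density \<open>\<bar>g\<bar> * \<bar>u\<bar> powr p\<close> is a probability measure, so Jensen's
inequality for the logarithm of \<open>\<bar>u\<bar> powr (r - p)\<close> bounds the left-hand side by \<open>p / (r - p) * ln I\<close>. The
theorem then follows from the capacitary inequality \<open>I \<le> H * (C_H p * D) powr (r / p)\<close>
(\<open>capacitary_inequality\<close>).

The capacitary inequality goes back to Maz'ya. For a test function \<open>\<phi>\<close> let \<open>c T\<close> be the capacity of the set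
where \<open>\<bar>\<phi>\<bar> powr p \<ge> T\<close>. The layer cake formula and the definition of \<open>H\<close> bound the integral of
\<open>\<bar>g\<bar> * \<bar>\<phi>\<bar> powr r\<close> by \<open>H\<close> times the integral of \<open>c T powr q\<close> with respect to \<open>T powr q\<close>, where
\<open>q = r / p > 1\<close>. Since \<open>c\<close> is decreasing, this is at most \<open>H\<close> times the \<open>q\<close>-th power of the integral of \<open>c\<close>
(\<open>antimono_powr_integral_le\<close>). It remains to see that the integral of \<open>c\<close> is at most \<open>C_H p\<close> times the energy
of \<open>\<phi>\<close> (\<open>capacity_strong_type\<close>).

For this, the explicit competitor \<open>min 1 ((\<bar>\<phi>\<bar> / t) powr a)\<close>, where \<open>t powr p = T\<close> and \<open>a > 1\<close>, is inserted
into the definition of the capacity (\<open>capacity_superlevel_le\<close>). After Tonelli's theorem its energy can be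
integrated over \<open>T\<close> in closed form, with the constant \<open>a powr p / (a - 1)\<close>. The choice \<open>a = p / (p - 1)\<close> is
optimal and gives exactly \<open>C_H p\<close>. The competitor is not smooth, but Weierstrass'
theorem approximates its profile by polynomials, and polynomials without constant term map test functions to test
functions.

The energy is defined through an arbitrary weak gradient, and the Beppo-Levi space as a completion. Weak gradients
are unique almost everywhere (\<open>weak_grad_unique\<close>), and an element of the space has the limit, in \<open>L\<close> with exponent
\<open>p\<close>, of the gradients of its approximating test functions as weak gradient. Hence the energies of these test
functions are eventually below any number larger than \<open>D\<close> (\<open>beppo_levi_approximation\<close>), and Fatou's lemma
carries the capacitary inequality over from test functions to \<open>u\<close>.
\<close>

section \<open>Smooth functions and test functions\<close>

lemma partial_deriv_eq:
  assumes "(f has_derivative f') (at x)"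
  shows "partial_deriv i f x = f' (axis i 1)"
  using frechet_derivative_at[OF assms] by (simp add: partial_deriv_def)

lemma Ck_imp_continuous: "Ck k f \<Longrightarrow> continuous_on UNIV f"
  by (cases k) (simp_all add: continuous_on_eq_continuous_within differentiable_imp_continuous_within)

lemma Ck_Suc_imp_Ck: "Ck (Suc k) f \<Longrightarrow> Ck k f"
proof (induction k arbitrary: f)
  case 0
  then show ?case using Ck_imp_continuous by (metis Ck.simps(1))
next
  case (Suc k)
  then show ?case by (metis Ck.simps(2))
qed

lemma Ck_const: "Ck k (\<lambda>x::real^'n. c)"
proof (induction k arbitrary: c)
  case (Suc k)
  have "partial_deriv i (\<lambda>x::real^'n. c) = (\<lambda>x. 0)" for i
    by (rule ext) (simp add: partial_deriv_eq[OF has_derivative_const])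
  then show ?case using Suc by simp
qed simp

lemma Ck_component: "Ck k (\<lambda>x::real^'n. x $ j)"
proof (cases k)
  case (Suc k')
  have d: "((\<lambda>x::real^'n. x $ j) has_derivative (\<lambda>x. x $ j)) (at x)" for x
    by (rule bounded_linear_imp_has_derivative) (rule bounded_linear_vec_nth)
  have "partial_deriv i (\<lambda>x::real^'n. x $ j) = (\<lambda>x. axis i 1 $ j)" for i
    by (rule ext) (simp add: partial_deriv_eq[OF d])
  then show ?thesis using Suc d Ck_const by (auto simp: differentiable_def simp del: Ck.simps(1))
next
  case 0 then show ?thesis by (auto intro!: continuous_intros)
qed

lemma Ck_add:
  assumes "Ck k f" "Ck k h" shows "Ck k (\<lambda>x. f x + h x)"
  using assms
proof (induction k arbitrary: f h)
  case 0 then show ?case by (auto intro!: continuous_intros)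
next
  case (Suc k)
  have "partial_deriv i (\<lambda>x. f x + h x) = (\<lambda>x. partial_deriv i f x + partial_deriv i h x)" for i
  proof
    fix x
    have "((\<lambda>x. f x + h x) has_derivative
        (\<lambda>v. frechet_derivative f (at x) v + frechet_derivative h (at x) v)) (at x)"
      using Suc.prems by (intro has_derivative_add) (auto simp: frechet_derivative_works)
    from partial_deriv_eq[OF this]
    show "partial_deriv i (\<lambda>x. f x + h x) x = partial_deriv i f x + partial_deriv i h x"
      by (simp add: partial_deriv_def)
  qed
  then show ?case using Suc by (auto intro!: differentiable_add)
qed

lemma partial_deriv_mult:
  assumes "f differentiable (at x)" "h differentiable (at x)"
  shows "partial_deriv i (\<lambda>x. f x * h x) x = f x * partial_deriv i h x + partial_deriv i f x * h x"
proof -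
  have "((\<lambda>x. f x * h x) has_derivative
      (\<lambda>v. f x * frechet_derivative h (at x) v + frechet_derivative f (at x) v * h x)) (at x)"
    using assms by (intro has_derivative_mult) (auto simp: frechet_derivative_works)
  from partial_deriv_eq[OF this] show ?thesis by (simp add: partial_deriv_def)
qed

lemma Ck_mult:
  assumes "Ck k f" "Ck k h" shows "Ck k (\<lambda>x. f x * h x)"
  using assms
proof (induction k arbitrary: f h)
  case 0 then show ?case by (auto intro!: continuous_intros)
next
  case (Suc k)
  have "partial_deriv i (\<lambda>x. f x * h x) = (\<lambda>x. f x * partial_deriv i h x + partial_deriv i f x * h x)" for i
    using Suc.prems by (intro ext partial_deriv_mult) auto
  moreover have "Ck k f" "Ck k h" using Suc.prems Ck_Suc_imp_Ck by blast+
  ultimately show ?case using Suc by (auto intro!: differentiable_mult Ck_add)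
qed

lemma Ck_prod:
  assumes "finite I" "\<And>i. i \<in> I \<Longrightarrow> Ck k (f i)"
  shows "Ck k (\<lambda>x. \<Prod>i\<in>I. f i x)"
  using assms by (induction I rule: finite_induct) (simp_all del: Ck.simps add: Ck_const Ck_mult)

lemma partial_deriv_chain:
  assumes "(h has_real_derivative d) (at (f x))" and "f differentiable (at x)"
  shows "partial_deriv i (\<lambda>x. h (f x)) x = d * partial_deriv i f x"
    and "(\<lambda>x. h (f x)) differentiable (at x)"
proof -
  have "((h \<circ> f) has_derivative ((*) d \<circ> frechet_derivative f (at x))) (at x)"
    using assms by (intro diff_chain_at) (auto simp: frechet_derivative_works has_field_derivative_def)
  then have *: "((\<lambda>x. h (f x)) has_derivative (\<lambda>v. d * frechet_derivative f (at x) v)) (at x)"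
    by (simp add: o_def)
  from partial_deriv_eq[OF this] show "partial_deriv i (\<lambda>x. h (f x)) x = d * partial_deriv i f x"
    by (simp add: partial_deriv_def)
  show "(\<lambda>x. h (f x)) differentiable (at x)" using * by (auto simp: differentiable_def)
qed

text \<open>The chain rule multiplies \<open>h' \<circ> f\<close> by a partial derivative of \<open>f\<close>. So an induction on \<open>k\<close>
  goes through as soon as \<open>h\<close> ranges over a family of one-variable functions that is closed under
  differentiation. It is used for the family of polynomials and for the family \<open>bump_fn Q\<close> below.\<close>
lemma Ck_compose:
  assumes F: "\<And>h. h \<in> F \<Longrightarrow> \<exists>h'\<in>F. \<forall>s. (h has_real_derivative h' s) (at s)"
    and "h \<in> F" and f: "\<And>j. Ck j f"
  shows "Ck k (\<lambda>x. h (f x))"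
  using \<open>h \<in> F\<close>
proof (induction k arbitrary: h)
  case 0
  obtain h' where "\<forall>s. (h has_real_derivative h' s) (at s)" using F[OF 0] by auto
  then have "continuous_on UNIV h" by (intro DERIV_continuous_on[where D=h']) auto
  moreover have "continuous_on UNIV f" using f[of 0] by simp
  ultimately show ?case by (auto intro!: continuous_on_compose2[of UNIV h])
next
  case (Suc k)
  obtain h' where h': "h' \<in> F" "\<And>s. (h has_real_derivative h' s) (at s)" using F[OF Suc.prems] by auto
  have df: "f differentiable (at x)" for x using f[of 1] by simp
  have "partial_deriv i (\<lambda>x. h (f x)) = (\<lambda>x. h' (f x) * partial_deriv i f x)" for i
    by (intro ext partial_deriv_chain(1) h' df)
  moreover have "Ck k (partial_deriv i f)" for i using f[of "Suc k"] by simp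
  ultimately show ?case
    using partial_deriv_chain(2)[where h=h, OF h'(2) df] Suc.IH[OF h'(1)] by (auto intro!: Ck_mult)
qed

lemma Ck_polynomial:
  assumes "real_polynomial_function h" "\<And>j. Ck j f"
  shows "Ck k (\<lambda>x. h (f x))"
proof (rule Ck_compose[where F = "Collect real_polynomial_function" and h = h and f = f])
  show "\<exists>h'\<in>Collect real_polynomial_function. \<forall>s. (h has_real_derivative h' s) (at s)"
    if "h \<in> Collect real_polynomial_function" for h :: "real \<Rightarrow> real"
    using has_real_derivative_polynomial_function[of h] that by blast
qed (use assms in auto)

text \<open>The classical function \<open>exp (- 1 / s)\<close>, cut off at \<open>0\<close>, is the case \<open>Q = 1\<close>. The factor
  \<open>Q (1 / s)\<close> is there because differentiation only changes the polynomial \<open>Q\<close>.\<close>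
definition bump_fn :: "(real \<Rightarrow> real) \<Rightarrow> real \<Rightarrow> real" where
  "bump_fn Q s = (if 0 < s then Q (1 / s) * exp (- (1 / s)) else 0)"

lemma polynomial_times_exp_tendsto_0:
  assumes "real_polynomial_function Q"
  shows "((\<lambda>y. Q y * exp (- y)) \<longlongrightarrow> 0) at_top"
proof -
  obtain a n where Q: "Q = (\<lambda>x. \<Sum>i\<le>n. a i * x ^ i)"
    using assms real_polynomial_function_iff_sum by blast
  have "((\<lambda>y::real. \<Sum>i\<le>n. a i * (y ^ i / exp y)) \<longlongrightarrow> 0) at_top"
    by (intro tendsto_null_sum tendsto_mult_right_zero tendsto_power_div_exp_0)
  then show ?thesis by (simp add: Q sum_distrib_right exp_minus divide_inverse mult.assoc)
qed

text \<open>The difference quotient at \<open>0\<close> is, from the right, \<open>y * Q y * exp (- y)\<close> with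
  \<open>y = 1 / s \<longrightarrow> \<infinity>\<close>, and the exponential beats the polynomial.\<close>
lemma bump_fn_deriv_0:
  assumes "real_polynomial_function Q"
  shows "(bump_fn Q has_real_derivative 0) (at 0)"
proof -
  have "real_polynomial_function (\<lambda>y. y * Q y)"
    by (rule real_polynomial_function.intros(4)[OF real_polynomial_function.intros(1)[OF bounded_linear_ident] assms])
  from polynomial_times_exp_tendsto_0[OF this]
  have "((\<lambda>s. inverse s * Q (inverse s) * exp (- inverse s)) \<longlongrightarrow> 0) (at_right 0)"
    by (rule filterlim_compose[OF _ filterlim_inverse_at_top_right])
  then have r: "((\<lambda>s. bump_fn Q s / s) \<longlongrightarrow> 0) (at_right 0)"
    by (rule Lim_transform_eventually)
      (auto simp: eventually_at_filter bump_fn_def field_simps)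
  have l: "((\<lambda>s. bump_fn Q s / s) \<longlongrightarrow> 0) (at_left 0)"
    by (rule Lim_transform_eventually[OF tendsto_const])
      (auto simp: eventually_at_filter bump_fn_def)
  have "((\<lambda>s. bump_fn Q s / s) \<longlongrightarrow> 0) (at 0)"
    using l r by (rule filterlim_split_at)
  then show ?thesis by (simp add: has_field_derivative_iff bump_fn_def)
qed

lemma bump_fn_derivative:
  assumes Q: "real_polynomial_function Q"
  obtains R where "real_polynomial_function R" "\<And>s. (bump_fn Q has_real_derivative bump_fn R s) (at s)"
proof -
  obtain Q' where Q': "real_polynomial_function Q'" "\<And>y. (Q has_real_derivative Q' y) (at y)"
    using has_real_derivative_polynomial_function[OF Q] by auto
  \<comment> \<open>With \<open>y = 1 / s\<close> and \<open>dy/ds = - y * y\<close>, the product rule gives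
    \<open>(Q y * exp (- y))' = - y * y * (Q' y - Q y) * exp (- y)\<close>.\<close>
  define R where "R = (\<lambda>y. (y * y) * (Q y - Q' y))"
  have R: "real_polynomial_function R"
    unfolding R_def using real_polynomial_function.intros(1)[OF bounded_linear_ident]
    by (intro real_polynomial_function.intros(4) real_polynomial_function_diff Q Q'(1))
  have "(bump_fn Q has_real_derivative bump_fn R s) (at s)" for s
  proof -
    consider "s < 0" | "s = 0" | "s > 0" by linarith
    then show ?thesis
    proof cases
      case 1
      have "((\<lambda>s. 0) has_real_derivative 0) (at s)" by simp
      then have "(bump_fn Q has_real_derivative 0) (at s)"
        by (rule has_field_derivative_transform_within_open[where S = "{..<0}"])
          (use 1 in \<open>auto simp: bump_fn_def\<close>)
      then show ?thesis using 1 by (simp add: bump_fn_def)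
    next
      case 2
      then show ?thesis using bump_fn_deriv_0[OF Q] by (simp add: bump_fn_def)
    next
      case 3
      have "((\<lambda>s. 1 / s) has_real_derivative - (1 / s * (1 / s))) (at s)"
        using 3 by (auto intro!: derivative_eq_intros simp: field_simps power2_eq_square)
      moreover note DERIV_chain2[OF Q'(2) this]
      ultimately have "((\<lambda>s. Q (1 / s) * exp (- (1 / s))) has_real_derivative
         Q' (1 / s) * - (1 / s * (1 / s)) * exp (- (1 / s)) +
         (exp (- (1 / s)) * - (- (1 / s * (1 / s)))) * Q (1 / s)) (at s)"
        by (intro DERIV_mult DERIV_chain2[OF DERIV_exp] DERIV_minus) auto
      moreover have "Q' (1 / s) * - (1 / s * (1 / s)) * exp (- (1 / s)) +
         (exp (- (1 / s)) * - (- (1 / s * (1 / s)))) * Q (1 / s) = bump_fn R s"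
        using 3 by (simp add: bump_fn_def R_def algebra_simps)
      ultimately have "((\<lambda>s. Q (1 / s) * exp (- (1 / s))) has_real_derivative bump_fn R s) (at s)"
        by simp
      then show ?thesis
        by (rule has_field_derivative_transform_within_open[where S = "{0<..}"])
          (use 3 in \<open>auto simp: bump_fn_def\<close>)
    qed
  qed
  then show thesis using that R by blast
qed

lemma Ck_bump:
  assumes "\<And>j. Ck j f"
  shows "Ck k (\<lambda>x. bump_fn (\<lambda>_. 1) (f x))"
proof (rule Ck_compose[where F = "bump_fn ` Collect real_polynomial_function" and f = f
      and h = "bump_fn (\<lambda>_. 1)"])
  show "bump_fn (\<lambda>_. 1) \<in> bump_fn ` Collect real_polynomial_function"
    by (auto intro: real_polynomial_function.intros)
  show "\<exists>h'\<in>bump_fn ` Collect real_polynomial_function. \<forall>s. (h has_real_derivative h' s) (at s)"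
    if "h \<in> bump_fn ` Collect real_polynomial_function" for h
    using that
  proof (rule imageE)
    fix Q assume h: "h = bump_fn Q" and Q: "Q \<in> Collect real_polynomial_function"
    obtain R where R: "real_polynomial_function R" "\<And>s. (bump_fn Q has_real_derivative bump_fn R s) (at s)"
      using bump_fn_derivative[of Q] Q unfolding mem_Collect_eq by metis
    show ?thesis unfolding h
      by (rule bexI[of _ "bump_fn R"]) (use R(2) in simp, rule imageI, simp add: R(1))
  qed
qed (rule assms)

lemma eq_0_outside_support: "x \<notin> closure {x. f x \<noteq> 0} \<Longrightarrow> f x = 0"
  using closure_subset[of "{x. f x \<noteq> 0}"] by blast

lemma test_functionI:
  assumes "\<And>k. Ck k f" "compact K" "\<And>x. x \<notin> K \<Longrightarrow> f x = 0"
  shows "f \<in> test_functions"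
proof -
  have "closure {x. f x \<noteq> 0} \<subseteq> K" using assms by (intro closure_minimal compact_imp_closed) auto
  then have "compact (closure {x. f x \<noteq> 0})"
    using assms(2) by (metis closed_closure compact_Int_closed inf.absorb_iff2)
  then show ?thesis using assms(1) by (simp add: test_functions_def)
qed

lemma test_function_support:
  assumes "f \<in> test_functions"
  shows "\<exists>K. compact K \<and> (\<forall>x. x \<notin> K \<longrightarrow> f x = 0)"
proof (intro exI conjI allI impI)
  show "compact (closure {x. f x \<noteq> 0})" using assms by (simp add: test_functions_def)
qed (rule eq_0_outside_support)

lemma test_function_Ck: "f \<in> test_functions \<Longrightarrow> Ck k f"
  by (simp add: test_functions_def)

lemma test_function_differentiable: "f \<in> test_functions \<Longrightarrow> f differentiable (at x)"
  using test_function_Ck[of f 1] by simp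

lemma test_function_continuous: "f \<in> test_functions \<Longrightarrow> continuous_on UNIV f"
  using test_function_Ck[of f 0] by simp

lemma partial_deriv_vanishes:
  assumes "closed K" "\<And>x. x \<notin> K \<Longrightarrow> f x = 0" "x \<notin> K"
  shows "partial_deriv i f x = 0"
proof -
  have "((\<lambda>x. 0) has_derivative (\<lambda>x. 0)) (at x)" by simp
  then have "(f has_derivative (\<lambda>x. 0)) (at x)"
    by (rule has_derivative_transform_within_open[where s = "- K"]) (use assms in auto)
  from partial_deriv_eq[OF this] show ?thesis by simp
qed

lemma test_function_partial_deriv:
  assumes "f \<in> test_functions"
  shows "partial_deriv i f \<in> test_functions"
proof -
  obtain K where K: "compact K" "\<And>x. x \<notin> K \<Longrightarrow> f x = 0" using test_function_support[OF assms] by metis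
  have "Ck k (partial_deriv i f)" for k using test_function_Ck[OF assms, of "Suc k"] by simp
  then show ?thesis using K(1)
    by (rule test_functionI) (use K partial_deriv_vanishes[OF compact_imp_closed[OF K(1)]] in auto)
qed

lemma test_function_diff:
  assumes "f \<in> test_functions" "h \<in> test_functions"
  shows "(\<lambda>x. f x - h x) \<in> test_functions"
proof -
  obtain K where K: "compact K" "\<And>x. x \<notin> K \<Longrightarrow> f x = 0" using test_function_support[OF assms(1)] by metis
  obtain L where L: "compact L" "\<And>x. x \<notin> L \<Longrightarrow> h x = 0" using test_function_support[OF assms(2)] by metis
  have "Ck k (\<lambda>x. f x + (- 1) * h x)" for k
    by (rule Ck_add[OF test_function_Ck[OF assms(1)] Ck_mult[OF Ck_const test_function_Ck[OF assms(2)]]])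
  then have "Ck k (\<lambda>x. f x - h x)" for k by simp
  then show ?thesis
    by (rule test_functionI[OF _ compact_Un[OF K(1) L(1)]]) (use K(2) L(2) in auto)
qed

text \<open>This is how competitors for the capacity of superlevel sets of \<open>f\<close> are produced: a polynomial of a
  test function is again a test function, whereas a truncation of \<open>f\<close> is not smooth.\<close>
lemma test_function_polynomial:
  assumes "real_polynomial_function h" "h 0 = 0" "f \<in> test_functions"
  shows "(\<lambda>x. h (f x)) \<in> test_functions"
proof -
  obtain K where K: "compact K" "\<And>x. x \<notin> K \<Longrightarrow> f x = 0" using test_function_support[OF assms(3)] by metis
  have "Ck k (\<lambda>x. h (f x))" for k
    using Ck_polynomial[OF assms(1) test_function_Ck[OF assms(3)]] .
  then show ?thesis
    by (rule test_functionI[OF _ K(1)]) (simp add: K(2) assms(2))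
qed

lemma test_function_bounded:
  assumes "f \<in> test_functions"
  obtains M where "M > 0" "\<And>x. \<bar>f x\<bar> \<le> M"
proof -
  obtain K where K: "compact K" "\<And>x. x \<notin> K \<Longrightarrow> f x = 0" using test_function_support[OF assms] by metis
  have "continuous_on K f"
    using test_function_continuous[OF assms] continuous_on_subset by blast
  then have "compact (f ` K)" by (rule compact_continuous_image[OF _ K(1)])
  then have "bounded (f ` K)" by (rule compact_imp_bounded)
  then obtain M where M: "M > 0" "\<And>y. y \<in> f ` K \<Longrightarrow> norm y \<le> M" unfolding bounded_pos by metis
  have "\<bar>f x\<bar> \<le> M" for x
  proof (cases "x \<in> K")
    case True then show ?thesis using M(2)[of "f x"] by simp
  next
    case False then show ?thesis using K(2) M(1) by simp
  qed
  then show thesis by (rule that[OF M(1)])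
qed

lemma test_function_measurable: "f \<in> test_functions \<Longrightarrow> f \<in> borel_measurable borel"
  using test_function_continuous by (rule borel_measurable_continuous_onI)

lemma borel_imp_lebesgue_measurable: "f \<in> borel_measurable borel \<Longrightarrow> f \<in> borel_measurable lebesgue"
  by (simp add: measurable_completion)

lemma continuous_compact_support_integrable:
  fixes f :: "'a::euclidean_space \<Rightarrow> real"
  assumes "continuous_on UNIV f" "compact K" "\<And>x. x \<notin> K \<Longrightarrow> f x = 0"
  shows "integrable lebesgue f"
proof -
  have "integrable lborel (\<lambda>x. indicator K x *\<^sub>R f x)"
    using assms(1,2) by (intro borel_integrable_compact) (auto intro: continuous_on_subset)
  also have "(\<lambda>x. indicator K x *\<^sub>R f x) = f" using assms(3) by (auto simp: fun_eq_iff indicator_def)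
  finally show ?thesis by (rule integrable_completion[THEN iffD2, rotated])
      (use assms(1) borel_measurable_continuous_onI in auto)
qed

section \<open>Integration by parts\<close>

lemma integrable_lebesgue_lborel:
  fixes f :: "'a::euclidean_space \<Rightarrow> real"
  assumes "f \<in> borel_measurable borel"
  shows "integrable lebesgue f \<longleftrightarrow> integrable lborel f" "integral\<^sup>L lebesgue f = integral\<^sup>L lborel f"
  using assms by (simp_all add: integrable_completion integral_completion)

lemma lebesgue_integral_translate:
  fixes f :: "'a::euclidean_space \<Rightarrow> real"
  assumes [measurable]: "f \<in> borel_measurable borel"
  shows "(LINT x|lebesgue. f (c + x)) = (LINT x|lebesgue. f x)"
    and "integrable lebesgue f \<Longrightarrow> integrable lebesgue (\<lambda>x. f (c + x))"
proof -
  have m: "(\<lambda>x. f (c + x)) \<in> borel_measurable borel" by measurable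
  have "(LINT x|lborel. f x) = (LINT x|distr lborel borel ((+) c). f x)"
    by (simp add: lborel_distr_plus)
  also have "\<dots> = (LINT x|lborel. f (c + x))" by (rule integral_distr) auto
  finally show "(LINT x|lebesgue. f (c + x)) = (LINT x|lebesgue. f x)"
    using m by (simp add: integrable_lebesgue_lborel)
  have "integrable (distr lborel borel ((+) c)) f \<longleftrightarrow> integrable lborel (\<lambda>x. f (c + x))"
    by (rule integrable_distr_eq) auto
  then show "integrable lebesgue f \<Longrightarrow> integrable lebesgue (\<lambda>x. f (c + x))"
    using m by (simp add: integrable_lebesgue_lborel lborel_distr_plus)
qed

lemma test_function_integrable: "f \<in> test_functions \<Longrightarrow> integrable lebesgue f"
  using test_function_support[of f] test_function_continuous continuous_compact_support_integrable
  by metis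

lemma has_real_derivative_along_axis:
  assumes "f differentiable (at (x + t *\<^sub>R axis i 1))"
  shows "((\<lambda>t. f (x + t *\<^sub>R axis i 1)) has_real_derivative partial_deriv i f (x + t *\<^sub>R axis i 1)) (at t)"
proof -
  let ?y = "x + t *\<^sub>R axis i 1"
  let ?D = "frechet_derivative f (at ?y)"
  have "((\<lambda>t. x + t *\<^sub>R axis i 1) has_derivative (\<lambda>h. h *\<^sub>R axis i 1)) (at t)"
    by (auto intro!: derivative_eq_intros)
  moreover have "(f has_derivative ?D) (at ?y)" using assms by (simp add: frechet_derivative_works)
  ultimately have "((\<lambda>t. f (x + t *\<^sub>R axis i 1)) has_derivative (\<lambda>h. ?D (h *\<^sub>R axis i 1))) (at t)"
    using has_derivative_compose by fastforce
  moreover have "?D (h *\<^sub>R axis i 1) = partial_deriv i f ?y * h" for h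
    using linear_frechet_derivative[OF assms] by (simp add: partial_deriv_def linear_cmul)
  ultimately show ?thesis by (simp add: has_field_derivative_def)
qed

lemma lipschitz_along_axis:
  assumes "f \<in> test_functions" "\<And>x. \<bar>partial_deriv i f x\<bar> \<le> M" "0 \<le> h"
  shows "\<bar>f (x + h *\<^sub>R axis i 1) - f x\<bar> \<le> M * h"
proof -
  have "norm (f (x + h *\<^sub>R axis i 1) - f (x + 0 *\<^sub>R axis i 1)) \<le> M * norm (h - 0)"
    by (rule field_differentiable_bound[where S = UNIV and f = "\<lambda>t. f (x + t *\<^sub>R axis i 1)"
          and f' = "\<lambda>t. partial_deriv i f (x + t *\<^sub>R axis i 1)"])
      (simp_all add: assms has_real_derivative_along_axis test_function_differentiable)
  then show ?thesis using assms(3) by simp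
qed

text \<open>Lebesgue measure is translation invariant, so every difference quotient of \<open>f\<close> in direction \<open>i\<close>
  has integral \<open>0\<close>. The quotients are bounded by the Lipschitz constant, live on a fixed ball, and
  converge to the partial derivative.\<close>
lemma integral_partial_deriv_eq_0:
  assumes f: "f \<in> test_functions"
  shows "(LINT x|lebesgue. partial_deriv i f x) = 0"
proof -
  obtain M where M: "M > 0" "\<And>x. \<bar>partial_deriv i f x\<bar> \<le> M"
    using test_function_bounded[OF test_function_partial_deriv[OF f]] by metis
  obtain K where K: "compact K" "\<And>x. x \<notin> K \<Longrightarrow> f x = 0" using test_function_support[OF f] by metis
  \<comment> \<open>Steps have length at most 1, so all difference quotients vanish outside the ball of radius \<open>R + 1\<close>.\<close>
  obtain R where R: "\<And>x. x \<in> K \<Longrightarrow> norm x \<le> R"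
    using compact_imp_bounded[OF K(1)] unfolding bounded_iff by metis
  define h where "h n = inverse (real (Suc n))" for n
  have h: "0 < h n" "h n \<le> 1" for n by (auto simp: h_def field_simps)
  define e where "e = (axis i 1 :: real^'a)"
  define q where "q n x = (f (x + h n *\<^sub>R e) - f x) / h n" for n x
  have meas[measurable]: "f \<in> borel_measurable borel" using f by (rule test_function_measurable)
  have fi: "integrable lebesgue f" using f by (rule test_function_integrable)
  have q0: "(LINT x|lebesgue. q n x) = 0" for n
  proof -
    have "integrable lebesgue (\<lambda>x. f (h n *\<^sub>R e + x))"
      by (rule lebesgue_integral_translate(2)[OF meas fi])
    then show ?thesis using fi lebesgue_integral_translate(1)[OF meas, of "h n *\<^sub>R e"]
      unfolding q_def by (simp add: add.commute)
  qed
  have bound: "\<bar>q n x\<bar> \<le> M * indicator (cball 0 (R + 1)) x" for n x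
  proof (cases "x \<in> cball 0 (R + 1)")
    case True
    then show ?thesis using lipschitz_along_axis[OF f M(2) less_imp_le[OF h(1)[of n]], of x] h(1)[of n]
      by (simp add: q_def e_def field_simps)
  next
    case False
    then have nx: "norm x > R + 1" by simp
    have "norm x \<le> norm (x + h n *\<^sub>R e) + norm (h n *\<^sub>R e)"
      by (metis add_diff_cancel_right' norm_triangle_ineq4)
    also have "norm (h n *\<^sub>R e) \<le> 1" using h[of n] by (simp add: e_def)
    finally have "x + h n *\<^sub>R e \<notin> K" "x \<notin> K" using R nx by fastforce+
    then show ?thesis using K(2) M(1) by (simp add: q_def)
  qed
  have "(\<lambda>n. LINT x|lebesgue. q n x) \<longlonglongrightarrow> (LINT x|lebesgue. partial_deriv i f x)"
  proof (rule integral_dominated_convergence[where w = "\<lambda>x. M * indicator (cball 0 (R + 1)) x"])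
    show "partial_deriv i f \<in> borel_measurable lebesgue"
      by (intro borel_imp_lebesgue_measurable test_function_measurable test_function_partial_deriv f)
    show "q n \<in> borel_measurable lebesgue" for n
      unfolding q_def by (intro borel_imp_lebesgue_measurable) measurable
    show "integrable lebesgue (\<lambda>x::real^'a. M * indicator (cball 0 (R + 1)) x :: real)"
      by (intro integrable_mult_right integrable_real_indicator) (use emeasure_lborel_cball_finite[of "0::real^'a" "R + 1"] in \<open>auto simp: top.not_eq_extremum\<close>)
    show "AE x in lebesgue. (\<lambda>n. q n x) \<longlonglongrightarrow> partial_deriv i f x"
    proof (rule AE_I2)
      fix x
      have "((\<lambda>t. f (x + t *\<^sub>R e)) has_real_derivative partial_deriv i f (x + 0 *\<^sub>R e)) (at 0)"
        unfolding e_def by (rule has_real_derivative_along_axis) (use test_function_differentiable[OF f] in simp)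
      then have "((\<lambda>t. (f (x + t *\<^sub>R e) - f x) / t) \<longlongrightarrow> partial_deriv i f x) (at 0)"
        by (simp add: has_field_derivative_iff)
      moreover have "filterlim h (at 0) sequentially"
        using LIMSEQ_inverse_real_of_nat h(1) unfolding h_def filterlim_at
        by (auto simp: less_imp_neq[THEN not_sym])
      ultimately show "(\<lambda>n. q n x) \<longlonglongrightarrow> partial_deriv i f x"
        unfolding q_def by (rule filterlim_compose)
    qed
    show "AE x in lebesgue. norm (q n x) \<le> M * indicator (cball 0 (R + 1)) x" for n
      using bound by simp
  qed
  then show ?thesis using q0 by (simp add: LIMSEQ_const_iff)
qed

lemma test_function_mult:
  assumes "f \<in> test_functions" "h \<in> test_functions"
  shows "(\<lambda>x. f x * h x) \<in> test_functions"
proof -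
  obtain K where K: "compact K" "\<And>x. x \<notin> K \<Longrightarrow> f x = 0" using test_function_support[OF assms(1)] by metis
  show ?thesis
    by (rule test_functionI[OF _ K(1)]) (auto intro: Ck_mult test_function_Ck assms simp: K(2) simp del: Ck.simps)
qed

lemma integration_by_parts_test_functions:
  assumes "f \<in> test_functions" "h \<in> test_functions"
  shows "(LINT x|lebesgue. f x * partial_deriv i h x) = - (LINT x|lebesgue. partial_deriv i f x * h x)"
proof -
  have "integrable lebesgue (\<lambda>x. f x * partial_deriv i h x)"
    "integrable lebesgue (\<lambda>x. partial_deriv i f x * h x)"
    by (intro test_function_integrable test_function_mult test_function_partial_deriv assms)+
  moreover have "(LINT x|lebesgue. f x * partial_deriv i h x + partial_deriv i f x * h x) = 0"
    using integral_partial_deriv_eq_0[OF test_function_mult[OF assms], of i]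
      partial_deriv_mult[OF assms[THEN test_function_differentiable], of i] by simp
  ultimately show ?thesis by simp
qed

section \<open>Uniqueness of weak gradients\<close>

lemma bump_fn_bounds: "0 \<le> bump_fn (\<lambda>_. 1) s" "bump_fn (\<lambda>_. 1) s \<le> 1"
  by (auto simp: bump_fn_def)

lemma bump_scaled_tendsto:
  "(\<lambda>n. bump_fn (\<lambda>_. 1) (real n * y)) \<longlonglongrightarrow> (if 0 < y then 1 else 0)"
proof (cases "0 < y")
  case True
  have "(\<lambda>n. exp (- ((1 / y) * inverse (real n)))) \<longlonglongrightarrow> exp (- ((1 / y) * 0))"
    by (intro tendsto_intros lim_inverse_n)
  then have "(\<lambda>n. exp (- ((1 / y) * inverse (real n)))) \<longlonglongrightarrow> 1" by simp
  moreover have "\<forall>\<^sub>F n in sequentially. exp (- ((1 / y) * inverse (real n))) = bump_fn (\<lambda>_. 1) (real n * y)"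
    using eventually_gt_at_top[of 0] by eventually_elim (use True in \<open>auto simp: bump_fn_def field_simps\<close>)
  ultimately show ?thesis using True by (simp add: tendsto_cong)
next
  case False
  then have "real n * y \<le> 0" for n by (simp add: mult_nonneg_nonpos)
  then have "bump_fn (\<lambda>_. 1) (real n * y) = 0" for n by (simp add: bump_fn_def not_less)
  then show ?thesis using False by simp
qed

text \<open>For fixed \<open>s > 0\<close> the value \<open>exp (- 1 / (n * s))\<close> tends to \<open>1\<close>, so these test functions converge
  to the indicator of the open box while staying below that of the closed box.\<close>
definition box_bump :: "real^'n \<Rightarrow> real^'n \<Rightarrow> nat \<Rightarrow> real^'n \<Rightarrow> real" where
  "box_bump a b n x = (\<Prod>i\<in>UNIV. bump_fn (\<lambda>_. 1) (real n * (x $ i - a $ i)) *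
     bump_fn (\<lambda>_. 1) (real n * (b $ i - x $ i)))"

lemma box_bump_outside:
  assumes "x \<notin> box a b" shows "box_bump a b n x = 0"
proof -
  obtain i where "x $ i \<le> a $ i \<or> b $ i \<le> x $ i"
    using assms by (auto simp: mem_box_cart not_less)
  then have "real n * (x $ i - a $ i) \<le> 0 \<or> real n * (b $ i - x $ i) \<le> 0"
    by (auto simp: mult_nonneg_nonpos)
  then have "bump_fn (\<lambda>_. 1) (real n * (x $ i - a $ i)) * bump_fn (\<lambda>_. 1) (real n * (b $ i - x $ i)) = 0"
    by (auto simp: bump_fn_def not_less)
  then show ?thesis unfolding box_bump_def by (intro prod_zero) auto
qed

lemma box_bump_test_function: "box_bump a b n \<in> test_functions"
proof (rule test_functionI)
  have lin: "Ck k (\<lambda>x::real^'a. real n * (c * x $ i + d))" for k i c d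
    by (intro Ck_mult Ck_const Ck_add Ck_component)
  have "Ck k (\<lambda>x::real^'a. bump_fn (\<lambda>_. 1) (real n * (1 * x $ i + - a $ i)))"
    "Ck k (\<lambda>x::real^'a. bump_fn (\<lambda>_. 1) (real n * (-1 * x $ i + b $ i)))" for k i
    by (rule Ck_bump[where f = "\<lambda>x::real^'a. real n * (c * x $ i + d)" for c d], rule lin)+
  then have "Ck k (\<lambda>x::real^'a. bump_fn (\<lambda>_. 1) (real n * (x $ i - a $ i)))"
    "Ck k (\<lambda>x::real^'a. bump_fn (\<lambda>_. 1) (real n * (b $ i - x $ i)))" for k i
    by (simp_all del: Ck.simps)
  then show "Ck k (box_bump a b n)" for k
    unfolding box_bump_def[abs_def] by (intro Ck_prod Ck_mult) auto
  show "compact (cbox a b)" by simp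
  show "box_bump a b n x = 0" if "x \<notin> cbox a b" for x
    using that box_subset_cbox box_bump_outside by blast
qed

lemma box_bump_le_indicator: "\<bar>box_bump a b n x\<bar> \<le> indicator (cbox a b) x"
proof (cases "x \<in> box a b")
  case True
  have "0 \<le> box_bump a b n x" "box_bump a b n x \<le> 1"
    unfolding box_bump_def by (intro prod_nonneg prod_le_1; simp add: bump_fn_bounds mult_le_one)+
  then show ?thesis using True box_subset_cbox by (fastforce simp: indicator_def)
qed (simp add: box_bump_outside)

lemma box_bump_tendsto_indicator: "(\<lambda>n. box_bump a b n x) \<longlonglongrightarrow> indicator (box a b) x"
proof -
  have "(\<lambda>n. box_bump a b n x) \<longlonglongrightarrow>
     (\<Prod>i\<in>UNIV. (if 0 < x $ i - a $ i then 1 else 0) * (if 0 < b $ i - x $ i then 1 else 0))"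
    unfolding box_bump_def by (intro tendsto_prod tendsto_mult bump_scaled_tendsto)
  also have "(\<Prod>i\<in>UNIV. (if 0 < x $ i - a $ i then 1 else 0) * (if 0 < b $ i - x $ i then 1 else 0))
      = (indicator (box a b) x :: real)"
  proof (cases "x \<in> box a b")
    case False
    then obtain i where i: "x $ i \<le> a $ i \<or> b $ i \<le> x $ i" by (auto simp: mem_box_cart not_less)
    then have "(if 0 < x $ i - a $ i then 1 else 0) * (if 0 < b $ i - x $ i then 1 else 0) = (0::real)" by auto
    then have "(\<Prod>i\<in>UNIV. (if 0 < x $ i - a $ i then 1 else 0) * (if 0 < b $ i - x $ i then 1 else 0)) = (0::real)"
      by (intro prod_zero bexI[of _ i]) simp_all
    then show ?thesis using False by simp
  qed (simp add: mem_box_cart)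
  finally show ?thesis .
qed

lemma integrable_locally_integrable_mult:
  fixes f h :: "real^'n \<Rightarrow> real"
  assumes f: "locally_integrable f" and h: "h \<in> borel_measurable borel" "compact K"
    "\<And>x. \<bar>h x\<bar> \<le> M" "\<And>x. x \<notin> K \<Longrightarrow> h x = 0"
  shows "integrable lebesgue (\<lambda>x. f x * h x)"
proof (rule Bochner_Integration.integrable_bound)
  have "integrable lebesgue (\<lambda>x. indicator K x *\<^sub>R f x)"
    using f h(2) by (simp add: locally_integrable_def set_integrable_def)
  then show "integrable lebesgue (\<lambda>x. M * (indicator K x *\<^sub>R f x))" by (rule integrable_mult_right)
  show "(\<lambda>x. f x * h x) \<in> borel_measurable lebesgue"
    using f borel_imp_lebesgue_measurable[OF h(1)]
    by (intro borel_measurable_times) (simp_all add: locally_integrable_def)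
  have "\<bar>f x\<bar> * \<bar>h x\<bar> \<le> \<bar>M\<bar> * \<bar>f x\<bar>" for x
    using mult_right_mono[OF order_trans[OF h(3)[of x] abs_ge_self], of "\<bar>f x\<bar>"] by (simp add: mult.commute)
  then show "AE x in lebesgue. norm (f x * h x) \<le> norm (M * (indicator K x *\<^sub>R f x))"
    using h(4) by (intro AE_I2) (auto simp: abs_mult indicator_def)
qed

lemma integrable_locally_integrable_mult_test:
  assumes "locally_integrable f" "\<phi> \<in> test_functions"
  shows "integrable lebesgue (\<lambda>x. f x * \<phi> x)"
proof -
  obtain M where "\<And>x. \<bar>\<phi> x\<bar> \<le> M" using test_function_bounded[OF assms(2)] by metis
  moreover obtain K where "compact K" "\<And>x. x \<notin> K \<Longrightarrow> \<phi> x = 0" using test_function_support[OF assms(2)] by metis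
  ultimately show ?thesis using assms test_function_measurable
    by (intro integrable_locally_integrable_mult[where K = K and M = M])
qed

text \<open>Testing with \<open>box_bump a b n\<close> and letting \<open>n\<close> tend to infinity shows that the integral of \<open>f\<close> over
  every box is \<open>0\<close>. By Lebesgue differentiation almost every value of \<open>f\<close> is a limit of averages over
  boxes.\<close>
lemma fundamental_lemma_calculus_of_variations:
  fixes f :: "real^'n \<Rightarrow> real"
  assumes f: "locally_integrable f" and 0: "\<And>\<phi>. \<phi> \<in> test_functions \<Longrightarrow> (LINT x|lebesgue. f x * \<phi> x) = 0"
  shows "AE x in lebesgue. f x = 0"
proof -
  have meas: "f \<in> borel_measurable lebesgue" using f by (simp add: locally_integrable_def)
  have ai: "f absolutely_integrable_on cbox a b" for a b
    using f by (simp add: locally_integrable_def)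
  have "integral (cbox a b) f = 0" for a b
  proof -
    have int: "integrable lebesgue (\<lambda>x. indicator (cbox a b) x *\<^sub>R f x)"
      using ai by (simp add: set_integrable_def)
    have "(\<lambda>n. LINT x|lebesgue. f x * box_bump a b n x) \<longlonglongrightarrow> (LINT x|lebesgue. f x * indicator (box a b) x)"
    proof (rule integral_dominated_convergence[where w = "\<lambda>x. norm (indicator (cbox a b) x *\<^sub>R f x)"])
      show "(\<lambda>x. f x * indicator (box a b) x) \<in> borel_measurable lebesgue"
        using meas by (intro borel_measurable_times borel_imp_lebesgue_measurable[OF borel_measurable_indicator]) auto
      show "(\<lambda>x. f x * box_bump a b n x) \<in> borel_measurable lebesgue" for n
        using meas borel_imp_lebesgue_measurable[OF test_function_measurable[OF box_bump_test_function]]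
        by (intro borel_measurable_times)
      show "integrable lebesgue (\<lambda>x. norm (indicator (cbox a b) x *\<^sub>R f x))"
        using int by (rule integrable_norm)
      show "AE x in lebesgue. (\<lambda>n. f x * box_bump a b n x) \<longlonglongrightarrow> f x * indicator (box a b) x"
        by (intro AE_I2 tendsto_mult tendsto_const box_bump_tendsto_indicator)
      show "AE x in lebesgue. norm (f x * box_bump a b n x) \<le> norm (indicator (cbox a b) x *\<^sub>R f x)" for n
      proof (rule AE_I2)
        fix x
        have "\<bar>f x\<bar> * \<bar>box_bump a b n x\<bar> \<le> \<bar>f x\<bar> * indicator (cbox a b) x"
          by (intro mult_left_mono box_bump_le_indicator) auto
        then show "norm (f x * box_bump a b n x) \<le> norm (indicator (cbox a b) x *\<^sub>R f x)"
          by (simp add: abs_mult mult.commute)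
      qed
    qed
    then have "(LINT x|lebesgue. f x * indicator (box a b) x) = 0"
      using 0[OF box_bump_test_function] by (simp add: LIMSEQ_const_iff)
    moreover have "set_integrable lebesgue (box a b) f"
      by (rule set_integrable_subset[OF ai[of a b]]) (auto simp: box_subset_cbox)
    from set_lebesgue_integral_eq_integral(2)[OF this]
    have "(LINT x|lebesgue. f x * indicator (box a b) x) = integral (box a b) f"
      by (simp add: set_lebesgue_integral_def mult.commute)
    ultimately show ?thesis using integral_open_interval[of a b f] by simp
  qed note box0 = this
  have "f integrable_on cbox a b" for a b
    using ai set_lebesgue_integral_eq_integral(1) by blast
  then obtain N where N: "negligible N" "\<And>x e. x \<notin> N \<Longrightarrow> 0 < e \<Longrightarrow> \<exists>d>0. \<forall>h. 0 < h \<and> h < d \<longrightarrow>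
      norm (integral (cbox x (x + h *\<^sub>R One)) f /\<^sub>R h ^ DIM(real^'n) - f x) < e"
    using integrable_ccontinuous_explicit[of f] by metis
  have "f x = 0" if x: "x \<notin> N" for x
  proof (rule ccontr)
    assume "f x \<noteq> 0"
    then obtain d where d: "d > 0" "\<And>h. 0 < h \<Longrightarrow> h < d \<Longrightarrow>
        norm (integral (cbox x (x + h *\<^sub>R One)) f /\<^sub>R h ^ DIM(real^'n) - f x) < \<bar>f x\<bar>"
      using N(2)[OF x, of "\<bar>f x\<bar>"] by auto
    from d(2)[of "d / 2"] d(1) show False by (simp add: box0)
  qed
  then show ?thesis using N(1)
    by (intro AE_I'[of N]) (auto simp: negligible_iff_null_sets)
qed

lemma locally_integrable_component:
  fixes G :: "real^'n \<Rightarrow> real^'m"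
  assumes "locally_integrable G" shows "locally_integrable (\<lambda>x. G x $ i)"
  unfolding locally_integrable_def
proof (intro conjI allI impI)
  have "(\<lambda>x. G x \<bullet> axis i 1) \<in> borel_measurable lebesgue"
    using assms by (intro borel_measurable_inner) (auto simp: locally_integrable_def)
  then show "(\<lambda>x. G x $ i) \<in> borel_measurable lebesgue" by (simp add: inner_axis)
  fix K :: "(real^'n) set" assume "compact K"
  then have "G absolutely_integrable_on K" using assms by (simp add: locally_integrable_def)
  from absolutely_integrable_component[OF this, of "axis i 1"]
  show "(\<lambda>x. G x $ i) absolutely_integrable_on K" by (simp add: inner_axis)
qed

lemma locally_integrable_diff:
  "locally_integrable f \<Longrightarrow> locally_integrable h \<Longrightarrow> locally_integrable (\<lambda>x. f x - h x)"
  by (auto simp: locally_integrable_def intro!: set_integral_diff borel_measurable_diff)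

lemma weak_grad_unique:
  assumes G: "is_weak_grad u G" and H: "is_weak_grad u H"
  shows "AE x in lebesgue. G x = H x"
proof -
  have "AE x in lebesgue. G x $ i - H x $ i = 0" for i
  proof (rule fundamental_lemma_calculus_of_variations)
    have *: "locally_integrable (\<lambda>x. G x $ i)" "locally_integrable (\<lambda>x. H x $ i)"
      using G H locally_integrable_component by (auto simp: is_weak_grad_def)
    then show "locally_integrable (\<lambda>x. G x $ i - H x $ i)" by (rule locally_integrable_diff)
    fix \<phi> :: "real^'a \<Rightarrow> real" assume \<phi>: "\<phi> \<in> test_functions"
    have "(LINT x|lebesgue. G x $ i * \<phi> x) = (LINT x|lebesgue. H x $ i * \<phi> x)"
      using bspec[OF conjunct2[OF conjunct2[OF G[unfolded is_weak_grad_def]]] \<phi>, rule_format, of i]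
        bspec[OF conjunct2[OF conjunct2[OF H[unfolded is_weak_grad_def]]] \<phi>, rule_format, of i]
      by linarith
    then show "(LINT x|lebesgue. (G x $ i - H x $ i) * \<phi> x) = 0"
      using *[THEN integrable_locally_integrable_mult_test[OF _ \<phi>]]
      by (simp add: left_diff_distrib)
  qed
  then have "AE x in lebesgue. \<forall>i\<in>UNIV. G x $ i - H x $ i = 0"
    by (intro AE_finite_allI) auto
  then show ?thesis by (rule AE_mp) (auto simp: vec_eq_iff)
qed

text \<open>The choice of a weak gradient in the definition of \<open>dirichlet\<close> is immaterial by uniqueness, so
  energies can be computed with any explicitly known weak gradient.\<close>
lemma dirichlet_eq:
  assumes "is_weak_grad u G"
  shows "dirichlet p u = (LINT x|lebesgue. norm (G x) powr p)"
proof -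
  have W: "is_weak_grad u (weak_grad u)" unfolding weak_grad_def by (rule someI[where P = "is_weak_grad u", OF assms])
  then have "weak_grad u \<in> borel_measurable lebesgue" "G \<in> borel_measurable lebesgue"
    using assms by (auto simp: is_weak_grad_def locally_integrable_def)
  then show ?thesis unfolding dirichlet_def
    using weak_grad_unique[OF W assms] by (intro integral_cong_AE) auto
qed

lemma continuous_imp_locally_integrable:
  fixes f :: "real^'n \<Rightarrow> 'b::euclidean_space"
  assumes "continuous_on UNIV f" shows "locally_integrable f"
  unfolding locally_integrable_def
proof (intro conjI allI impI)
  show "f \<in> borel_measurable lebesgue"
    using borel_measurable_continuous_onI[OF assms] by (simp add: measurable_completion)
  fix K :: "(real^'n) set" assume K: "compact K"
  have "integrable lborel (\<lambda>x. indicator K x *\<^sub>R f x)"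
    using K continuous_on_subset[OF assms] by (intro borel_integrable_compact) auto
  then show "f absolutely_integrable_on K"
    unfolding set_integrable_def using borel_measurable_continuous_onI[OF assms] K
    by (subst integrable_completion) (auto intro!: borel_measurable_scaleR borel_measurable_indicator borel_compact)
qed

lemma grad_continuous:
  assumes "\<phi> \<in> test_functions" shows "continuous_on UNIV (grad \<phi>)"
  unfolding grad_def using test_function_continuous[OF test_function_partial_deriv[OF assms]]
  by (intro continuous_on_vec_lambda) 

lemma is_weak_grad_grad:
  assumes "\<phi> \<in> test_functions" shows "is_weak_grad \<phi> (grad \<phi>)"
  unfolding is_weak_grad_def
  using assms test_function_continuous grad_continuous
  by (auto intro!: continuous_imp_locally_integrable integration_by_parts_test_functions simp: grad_def)

lemma dirichlet_test_function:
  "\<phi> \<in> test_functions \<Longrightarrow> dirichlet p \<phi> = (LINT x|lebesgue. norm (grad \<phi> x) powr p)"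
  by (rule dirichlet_eq[OF is_weak_grad_grad])

section \<open>Approximation by test functions in the Beppo-Levi space\<close>

lemma ennreal_tendsto_0I:
  fixes X :: "'a \<Rightarrow> ennreal"
  assumes "\<And>e::real. e > 0 \<Longrightarrow> eventually (\<lambda>n. X n \<le> ennreal e) F"
  shows "(X \<longlongrightarrow> 0) F"
proof (rule order_tendstoI)
  fix a :: ennreal assume "0 < a"
  then obtain e where e: "e > 0" "ennreal e < a"
  proof (cases a)
    case (real r)
    then show thesis using \<open>0 < a\<close> by (intro that[of "r / 2"]) (auto simp: ennreal_lessI)
  next
    case top then show thesis by (intro that[of 1]) auto
  qed
  show "eventually (\<lambda>n. X n < a) F" using assms[OF e(1)] by eventually_elim (use e(2) in auto)
qed simp

lemma ennreal_tendsto_0D: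
  fixes X :: "'a \<Rightarrow> ennreal"
  assumes "(X \<longlongrightarrow> 0) F" "0 < (e::real)"
  shows "eventually (\<lambda>n. X n \<le> ennreal e) F"
proof -
  have "eventually (\<lambda>n. X n < ennreal e) F" using assms by (intro order_tendstoD(2)[OF assms(1)]) simp
  then show ?thesis by eventually_elim simp
qed

lemma nn_integral_fatou_bound:
  fixes f :: "nat \<Rightarrow> 'a \<Rightarrow> ennreal"
  assumes "\<And>n. f n \<in> borel_measurable M" "AE x in M. (\<lambda>n. f n x) \<longlonglongrightarrow> g x"
    "eventually (\<lambda>n. (\<integral>\<^sup>+ x. f n x \<partial>M) \<le> B) sequentially"
  shows "(\<integral>\<^sup>+ x. g x \<partial>M) \<le> B"
proof -
  have "(\<integral>\<^sup>+ x. g x \<partial>M) = (\<integral>\<^sup>+ x. liminf (\<lambda>n. f n x) \<partial>M)"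
  proof (rule nn_integral_cong_AE)
    show "AE x in M. g x = liminf (\<lambda>n. f n x)"
      using assms(2) by (rule AE_mp) (auto simp: lim_imp_Liminf)
  qed
  also have "\<dots> \<le> liminf (\<lambda>n. \<integral>\<^sup>+ x. f n x \<partial>M)" by (rule nn_integral_liminf) (rule assms(1))
  also have "\<dots> \<le> limsup (\<lambda>n. \<integral>\<^sup>+ x. f n x \<partial>M)" by (rule Liminf_le_Limsup) simp
  also have "\<dots> \<le> B" using assms(3) by (rule Limsup_bounded)
  finally show ?thesis .
qed

text \<open>Convexity of \<open>z powr p\<close> applied to \<open>x + y = l * (x / l) + (1 - l) * (y / (1 - l))\<close>. As \<open>l\<close> tends
  to \<open>1\<close> the factor of \<open>x powr p\<close> tends to \<open>1\<close>, so this replaces the triangle inequality of \<open>L\<close> with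
  exponent \<open>p\<close> when one compares energies up to an arbitrarily small error.\<close>
lemma powr_sum_le_convex:
  fixes x y p l :: real
  assumes "0 \<le> x" "0 \<le> y" "1 \<le> p" "0 < l" "l < 1"
  shows "(x + y) powr p \<le> l powr (1 - p) * x powr p + (1 - l) powr (1 - p) * y powr p"
proof -
  have *: "m * (z / m) powr p = m powr (1 - p) * z powr p" if "0 < m" "0 \<le> z" for m z :: real
  proof -
    have "m * (z / m) powr p = (m powr 1 * m powr (- p)) * z powr p"
      using that by (simp add: powr_divide powr_minus field_simps)
    also have "m powr 1 * m powr (- p) = m powr (1 - p)" by (subst powr_add[symmetric]) simp
    finally show ?thesis .
  qed
  show ?thesis
  proof (cases "x = 0 \<or> y = 0")
    case True
    have "1 \<le> m powr (1 - p)" if "0 < m" "m < 1" for m :: real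
      using that assms(3) powr_mono'[of "1 - p" 0 m] by simp
    then have "1 \<le> l powr (1 - p)" "1 \<le> (1 - l) powr (1 - p)" using assms by auto
    then have "1 * x powr p \<le> l powr (1 - p) * x powr p" "1 * y powr p \<le> (1 - l) powr (1 - p) * y powr p"
      by (intro mult_right_mono; simp)+
    then show ?thesis using True by auto
  next
    case False
    then have "0 < x / l" "0 < y / (1 - l)" using assms by auto
    from convex_onD[OF powr_convex[OF assms(3)], of "1 - l" "x / l" "y / (1 - l)"] this assms
    have "(l * (x / l) + (1 - l) * (y / (1 - l))) powr p \<le> l * (x / l) powr p + (1 - l) * (y / (1 - l)) powr p"
      by simp
    also have "l * (x / l) + (1 - l) * (y / (1 - l)) = x + y" using assms by simp
    finally show ?thesis using * assms by simp
  qed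
qed

text \<open>Where \<open>x > e\<close>, the factor \<open>(x / e) powr (q - 1)\<close> is at least \<open>1\<close>. This is a substitute for
  Hoelder's inequality on sets of finite measure.\<close>
lemma le_eps_plus_powr:
  fixes x e q :: real
  assumes "0 \<le> x" "0 < e" "1 \<le> q"
  shows "x \<le> e + e powr (1 - q) * x powr q"
proof (cases "x \<le> e")
  case False
  then have "1 \<le> (x / e) powr (q - 1)" using assms by (intro ge_one_powr_ge_zero) auto
  then have "x * 1 \<le> x * (x / e) powr (q - 1)" using assms by (intro mult_left_mono) auto
  also have "(x / e) powr (q - 1) = x powr (q - 1) * e powr (1 - q)"
    using False assms powr_minus_divide[of e "q - 1"] by (simp add: powr_divide)
  also have "x * (x powr (q - 1) * e powr (1 - q)) = (x powr 1 * x powr (q - 1)) * e powr (1 - q)"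
    using False assms by simp
  also have "x powr 1 * x powr (q - 1) = x powr q" by (subst powr_add[symmetric]) simp
  finally show ?thesis using assms by (simp add: mult.commute)
next
  case True
  have "0 \<le> e powr (1 - q) * x powr q" by simp
  then show ?thesis using True by linarith
qed

lemma L1_convergence_from_Lq:
  fixes f :: "nat \<Rightarrow> 'a::euclidean_space \<Rightarrow> 'b::euclidean_space" and w :: "'a \<Rightarrow> real"
  assumes f: "\<And>n. f n \<in> borel_measurable lebesgue" "F \<in> borel_measurable lebesgue"
    and q: "1 \<le> q" and lim: "(\<lambda>n. \<integral>\<^sup>+ x. ennreal (norm (f n x - F x) powr q) \<partial>lebesgue) \<longlonglongrightarrow> 0"
    and w: "compact K" "\<And>x. \<bar>w x\<bar> \<le> M" "\<And>x. x \<notin> K \<Longrightarrow> w x = 0" "M > 0"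
  shows "(\<lambda>n. \<integral>\<^sup>+ x. ennreal (norm (f n x - F x) * \<bar>w x\<bar>) \<partial>lebesgue) \<longlonglongrightarrow> 0"
proof (rule ennreal_tendsto_0I)
  fix d :: real assume d: "d > 0"
  have Kf: "emeasure lebesgue K < \<infinity>" and Ks: "K \<in> sets lebesgue"
    using w(1) lmeasurable_compact by (auto simp: fmeasurable_def)
  define \<mu> where "\<mu> = measure lebesgue K"
  have \<mu>: "emeasure lebesgue K = ennreal \<mu>" "0 \<le> \<mu>"
    using Kf unfolding \<mu>_def by (auto simp: emeasure_eq_ennreal_measure)
  \<comment> \<open>With this \<open>e\<close> the constant term \<open>e\<close> of the pointwise bound contributes at most \<open>d / 2\<close>.\<close>
  define e where "e = d / (2 * M * (\<mu> + 1))"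
  have e: "e > 0" using d w(4) \<mu>(2) by (simp add: e_def)
  define C where "C = M * e powr (1 - q)"
  have C: "C > 0" using w(4) e by (simp add: C_def)
  define I where "I n = (\<integral>\<^sup>+ x. ennreal (norm (f n x - F x) powr q) \<partial>lebesgue)" for n
  have "M * e * \<mu> \<le> d / 2"
  proof -
    have "M * e * \<mu> = (d / 2) * (\<mu> / (\<mu> + 1))" using w(4) by (simp add: e_def)
    also have "\<dots> \<le> (d / 2) * 1" using d \<mu>(2) by (intro mult_left_mono) auto
    finally show ?thesis by simp
  qed
  note small = this
  have m[measurable]: "(\<lambda>x. norm (f n x - F x) powr q) \<in> borel_measurable lebesgue" for n
    using f by measurable
  have [measurable]: "K \<in> sets lebesgue" by (rule Ks)
  have bound: "(\<integral>\<^sup>+ x. ennreal (norm (f n x - F x) * \<bar>w x\<bar>) \<partial>lebesgue) \<le> ennreal (M * e * \<mu>) + ennreal C * I n" for n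
  proof -
    have pt: "norm (f n x - F x) * \<bar>w x\<bar> \<le> M * e * indicator K x + C * norm (f n x - F x) powr q" for x
    proof (cases "x \<in> K")
      case True
      have "norm (f n x - F x) * \<bar>w x\<bar> \<le> (e + e powr (1 - q) * norm (f n x - F x) powr q) * M"
        using le_eps_plus_powr[OF norm_ge_zero e q] w(2)[of x] e
        by (intro mult_mono add_nonneg_nonneg mult_nonneg_nonneg) auto
      then show ?thesis using True by (simp add: C_def algebra_simps)
    next
      case False then show ?thesis using w(3) C by simp
    qed
    have "(\<integral>\<^sup>+ x. ennreal (norm (f n x - F x) * \<bar>w x\<bar>) \<partial>lebesgue)
      \<le> (\<integral>\<^sup>+ x. ennreal (M * e) * indicator K x + ennreal C * ennreal (norm (f n x - F x) powr q) \<partial>lebesgue)"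
    proof (rule nn_integral_mono)
      fix x
      have "ennreal (norm (f n x - F x) * \<bar>w x\<bar>) \<le> ennreal (M * e * indicator K x + C * norm (f n x - F x) powr q)"
        by (rule ennreal_leI[OF pt])
      also have "\<dots> = ennreal (M * e) * indicator K x + ennreal C * ennreal (norm (f n x - F x) powr q)"
        using C w(4) e by (subst ennreal_plus) (auto simp: ennreal_mult' indicator_def)
      finally show "ennreal (norm (f n x - F x) * \<bar>w x\<bar>)
        \<le> ennreal (M * e) * indicator K x + ennreal C * ennreal (norm (f n x - F x) powr q)" .
    qed
    also have "\<dots> = ennreal (M * e) * emeasure lebesgue K + ennreal C * I n"
      unfolding I_def by (simp add: nn_integral_add nn_integral_cmult nn_integral_cmult_indicator)
    also have "ennreal (M * e) * emeasure lebesgue K = ennreal (M * e * \<mu>)"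
      using \<mu> w(4) e by (simp add: ennreal_mult')
    finally show ?thesis .
  qed
  have "eventually (\<lambda>n. I n \<le> ennreal (d / (2 * C))) sequentially"
    using ennreal_tendsto_0D[OF lim, of "d / (2 * C)"] d C unfolding I_def by simp
  then show "eventually (\<lambda>n. (\<integral>\<^sup>+ x. ennreal (norm (f n x - F x) * \<bar>w x\<bar>) \<partial>lebesgue) \<le> ennreal d) sequentially"
  proof eventually_elim
    case (elim n)
    have "(\<integral>\<^sup>+ x. ennreal (norm (f n x - F x) * \<bar>w x\<bar>) \<partial>lebesgue) \<le> ennreal (M * e * \<mu>) + ennreal C * I n"
      by (rule bound)
    also have "\<dots> \<le> ennreal (d / 2) + ennreal C * ennreal (d / (2 * C))"
      using small elim by (intro add_mono mult_left_mono ennreal_leI) auto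
    also have "\<dots> = ennreal d" using d C
      by (simp add: ennreal_mult'[symmetric] ennreal_plus[symmetric] del: ennreal_plus)
    finally show ?case .
  qed
qed

lemma Lq_limit_locally_integrable:
  fixes F h :: "real^'n \<Rightarrow> 'b::euclidean_space"
  assumes F: "F \<in> borel_measurable lebesgue" and h: "locally_integrable h"
    and q: "1 \<le> q" and fin: "(\<integral>\<^sup>+ x. ennreal (norm (F x - h x) powr q) \<partial>lebesgue) < \<infinity>"
  shows "locally_integrable F"
  unfolding locally_integrable_def
proof (intro conjI allI impI F)
  fix K :: "(real^'n) set" assume K: "compact K"
  have hm: "h \<in> borel_measurable lebesgue" using h by (simp add: locally_integrable_def)
  have Kf: "K \<in> lmeasurable" using K by (rule lmeasurable_compact)
  have "integrable lebesgue (\<lambda>x. indicator K x + norm (F x - h x) powr q :: real)"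
  proof (rule Bochner_Integration.integrable_add)
    show "integrable lebesgue (indicator K :: _ \<Rightarrow> real)" using Kf by (intro integrable_real_indicator) (auto simp: fmeasurable_def)
    show "integrable lebesgue (\<lambda>x. norm (F x - h x) powr q)"
      using fin F hm by (intro integrableI_bounded) auto
  qed
  then have "integrable lebesgue (\<lambda>x. indicator K x *\<^sub>R (F x - h x))"
  proof (rule Bochner_Integration.integrable_bound)
    show "(\<lambda>x. indicator K x *\<^sub>R (F x - h x)) \<in> borel_measurable lebesgue"
      using Kf F hm by (intro borel_measurable_scaleR borel_measurable_indicator borel_measurable_diff) auto
    show "AE x in lebesgue. norm (indicator K x *\<^sub>R (F x - h x)) \<le> norm (indicator K x + norm (F x - h x) powr q)"
      using le_eps_plus_powr[OF norm_ge_zero _ q, of 1] by (intro AE_I2) (auto simp: indicator_def)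
  qed
  then have "(\<lambda>x. F x - h x) absolutely_integrable_on K" by (simp add: set_integrable_def)
  moreover have "h absolutely_integrable_on K" using h K by (simp add: locally_integrable_def)
  ultimately have "(\<lambda>x. (F x - h x) + h x) absolutely_integrable_on K" by (rule set_integral_add)
  then show "F absolutely_integrable_on K" by simp
qed

text \<open>If the series is finite, its terms are bounded, so the increments decay like \<open>(1 / 2) ^ k\<close>.\<close>
lemma geometric_increments_imp_convergent:
  fixes f :: "nat \<Rightarrow> 'b::banach" and p :: real
  assumes p: "0 < p" and fin: "(\<Sum>k. ennreal (2 powr (k * p) * norm (f (Suc k) - f k) powr p)) \<noteq> \<infinity>"
  shows "convergent f"
proof -
  define X where "X = (\<Sum>k. ennreal (2 powr (k * p) * norm (f (Suc k) - f k) powr p))"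
  obtain S where S: "0 \<le> S" "X = ennreal S"
    using fin unfolding X_def[symmetric] by (cases X) simp_all
  have le: "norm (f (Suc k) - f k) \<le> S powr (1 / p) * (1 / 2) ^ k" for k
  proof -
    have "sum (\<lambda>k. ennreal (2 powr (k * p) * norm (f (Suc k) - f k) powr p)) {k}
       \<le> X"
      unfolding X_def by (rule sum_le_suminf) simp_all
    then have "2 powr (k * p) * norm (f (Suc k) - f k) powr p \<le> S" using S by simp
    moreover have "2 powr (k * p) * norm (f (Suc k) - f k) powr p = (2 ^ k * norm (f (Suc k) - f k)) powr p"
      by (simp add: powr_mult powr_powr[symmetric] powr_realpow)
    ultimately have "((2 ^ k * norm (f (Suc k) - f k)) powr p) powr (1 / p) \<le> S powr (1 / p)"
      using p by (intro powr_mono2) auto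
    then have "2 ^ k * norm (f (Suc k) - f k) \<le> S powr (1 / p)" using p by (simp add: powr_powr)
    then show ?thesis by (simp add: field_simps)
  qed
  have "summable (\<lambda>k. f (Suc k) - f k)"
    by (rule summable_comparison_test'[where g = "\<lambda>k. S powr (1 / p) * (1 / 2) ^ k" and N = 0])
      (use le in \<open>auto intro!: summable_mult summable_geometric\<close>)
  then have "convergent (\<lambda>n. f n - f 0)"
    by (simp add: summable_iff_convergent sum_lessThan_telescope)
  from convergent_add[OF this convergent_const[of "f 0"]] show ?thesis by simp
qed

text \<open>Along a subsequence with rapidly decreasing distances the weighted sum of the powers of the increments
  has finite integral, so it is finite almost everywhere and the subsequence converges there. Fatou's
  lemma turns the Cauchy condition into convergence of the whole sequence.\<close>
lemma Lp_complete:
  fixes f :: "nat \<Rightarrow> 'a \<Rightarrow> 'b::{banach, second_countable_topology}" and p :: real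
  assumes meas: "\<And>n. f n \<in> borel_measurable M" and p: "0 < p"
    and cauchy: "\<And>e::real. e > 0 \<Longrightarrow>
      \<exists>K. \<forall>m\<ge>K. \<forall>n\<ge>K. (\<integral>\<^sup>+ x. ennreal (norm (f m x - f n x) powr p) \<partial>M) \<le> ennreal e"
  shows "\<exists>F. F \<in> borel_measurable M \<and>
    (\<lambda>n. \<integral>\<^sup>+ x. ennreal (norm (f n x - F x) powr p) \<partial>M) \<longlonglongrightarrow> 0"
proof -
  note meas[measurable]
  \<comment> \<open>The first factor cancels the weight \<open>2 powr (k * p)\<close>; the second one makes the sum finite.\<close>
  define \<delta> where "\<delta> k = 2 powr (- (real k * p)) * (1 / 2) ^ k" for k :: nat
  have "\<forall>k. \<exists>K. \<forall>m\<ge>K. \<forall>n\<ge>K. (\<integral>\<^sup>+ x. ennreal (norm (f m x - f n x) powr p) \<partial>M) \<le> ennreal (\<delta> k)"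
    by (intro allI cauchy) (simp add: \<delta>_def)
  then obtain N where N: "\<And>k m n. N k \<le> m \<Longrightarrow> N k \<le> n \<Longrightarrow>
      (\<integral>\<^sup>+ x. ennreal (norm (f m x - f n x) powr p) \<partial>M) \<le> ennreal (\<delta> k)"
    by metis
  define s where "s k = (\<Sum>j\<le>k. N j) + k" for k
  have s: "N k \<le> s k" "N k \<le> s (Suc k)" "k \<le> s k" for k
    using member_le_sum[of k "{..k}" N] by (auto simp: s_def)
  define F where "F x = lim (\<lambda>k. f (s k) x)" for x
  have F[measurable]: "F \<in> borel_measurable M" unfolding F_def by measurable
  have "(\<integral>\<^sup>+ x. (\<Sum>k. ennreal (2 powr (k * p) * norm (f (s (Suc k)) x - f (s k) x) powr p)) \<partial>M)
      = (\<Sum>k. \<integral>\<^sup>+ x. ennreal (2 powr (k * p) * norm (f (s (Suc k)) x - f (s k) x) powr p) \<partial>M)"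
    by (rule nn_integral_suminf) measurable
  also have "\<dots> \<le> (\<Sum>k. ennreal ((1 / 2) ^ k))"
  proof (rule suminf_le)
    fix k
    have "(\<integral>\<^sup>+ x. ennreal (2 powr (k * p) * norm (f (s (Suc k)) x - f (s k) x) powr p) \<partial>M)
        = ennreal (2 powr (k * p)) * (\<integral>\<^sup>+ x. ennreal (norm (f (s (Suc k)) x - f (s k) x) powr p) \<partial>M)"
      by (simp add: ennreal_mult' nn_integral_cmult)
    also have "\<dots> \<le> ennreal (2 powr (k * p)) * ennreal (\<delta> k)"
      by (intro mult_left_mono N s) simp
    also have "\<dots> = ennreal (2 powr (k * p) * \<delta> k)" by (simp add: ennreal_mult')
    also have "2 powr (k * p) * \<delta> k = (1 / 2) ^ k"
      unfolding \<delta>_def mult.assoc[symmetric] by (simp add: powr_add[symmetric])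
    finally show "(\<integral>\<^sup>+ x. ennreal (2 powr (k * p) * norm (f (s (Suc k)) x - f (s k) x) powr p) \<partial>M) \<le> ennreal ((1 / 2) ^ k)" .
  qed auto
  also have "\<dots> = ennreal (\<Sum>k. (1 / 2) ^ k)"
    by (intro suminf_ennreal2 summable_geometric) auto
  finally have "(\<integral>\<^sup>+ x. (\<Sum>k. ennreal (2 powr (k * p) * norm (f (s (Suc k)) x - f (s k) x) powr p)) \<partial>M) \<noteq> \<infinity>"
    by (metis ennreal_neq_top infinity_ennreal_def top.extremum_unique)
  then have "AE x in M. (\<Sum>k. ennreal (2 powr (k * p) * norm (f (s (Suc k)) x - f (s k) x) powr p)) \<noteq> \<infinity>"
    by (intro nn_integral_PInf_AE) measurable
  then have conv: "AE x in M. (\<lambda>k. f (s k) x) \<longlonglongrightarrow> F x"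
  proof (rule AE_mp, intro AE_I2 impI)
    fix x assume "(\<Sum>k. ennreal (2 powr (k * p) * norm (f (s (Suc k)) x - f (s k) x) powr p)) \<noteq> \<infinity>"
    then have "convergent (\<lambda>k. f (s k) x)" by (rule geometric_increments_imp_convergent[OF p])
    then show "(\<lambda>k. f (s k) x) \<longlonglongrightarrow> F x" by (simp add: convergent_LIMSEQ_iff F_def)
  qed
  have "(\<lambda>n. \<integral>\<^sup>+ x. ennreal (norm (f n x - F x) powr p) \<partial>M) \<longlonglongrightarrow> 0"
  proof (rule ennreal_tendsto_0I)
    fix e :: real assume "e > 0"
    then obtain K where K: "\<And>m n. K \<le> m \<Longrightarrow> K \<le> n \<Longrightarrow>
        (\<integral>\<^sup>+ x. ennreal (norm (f m x - f n x) powr p) \<partial>M) \<le> ennreal e" using cauchy by metis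
    show "eventually (\<lambda>n. (\<integral>\<^sup>+ x. ennreal (norm (f n x - F x) powr p) \<partial>M) \<le> ennreal e) sequentially"
      using eventually_ge_at_top[of K]
    proof eventually_elim
      case (elim n)
      show ?case
      proof (rule nn_integral_fatou_bound[where f = "\<lambda>k x. ennreal (norm (f n x - f (s k) x) powr p)"])
        show "AE x in M. (\<lambda>k. ennreal (norm (f n x - f (s k) x) powr p)) \<longlonglongrightarrow> ennreal (norm (f n x - F x) powr p)"
          using conv
        proof (rule AE_mp, intro AE_I2 impI)
          fix x assume "(\<lambda>k. f (s k) x) \<longlonglongrightarrow> F x"
          then have "(\<lambda>k. norm (f n x - f (s k) x)) \<longlonglongrightarrow> norm (f n x - F x)" by (intro tendsto_intros)
          then have "(\<lambda>k. norm (f n x - f (s k) x) powr p) \<longlonglongrightarrow> norm (f n x - F x) powr p"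
            using p by (intro tendsto_powr'[OF _ tendsto_const]) auto
          then show "(\<lambda>k. ennreal (norm (f n x - f (s k) x) powr p)) \<longlonglongrightarrow> ennreal (norm (f n x - F x) powr p)"
            by (intro tendsto_ennrealI)
        qed
        show "eventually (\<lambda>k. (\<integral>\<^sup>+ x. ennreal (norm (f n x - f (s k) x) powr p) \<partial>M) \<le> ennreal e) sequentially"
          using eventually_ge_at_top[of K] by eventually_elim (use K elim s(3) order_trans in blast)
      qed measurable
    qed
  qed
  with F show ?thesis by blast
qed

lemma grad_diff:
  assumes "f \<in> test_functions" "h \<in> test_functions"
  shows "grad (\<lambda>x. f x - h x) x = grad f x - grad h x"
proof -
  have "((\<lambda>x. f x - h x) has_derivative
      (\<lambda>v. frechet_derivative f (at x) v - frechet_derivative h (at x) v)) (at x)"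
    using assms[THEN test_function_differentiable, of x]
    by (intro has_derivative_diff) (auto simp: frechet_derivative_works)
  from partial_deriv_eq[OF this]
  have "partial_deriv i (\<lambda>x. f x - h x) x = partial_deriv i f x - partial_deriv i h x" for i
    by (simp add: partial_deriv_def)
  then show ?thesis by (simp add: grad_def vec_eq_iff)
qed

lemma grad_vanishes:
  assumes "\<phi> \<in> test_functions"
  shows "\<exists>K. compact K \<and> (\<forall>x. x \<notin> K \<longrightarrow> grad \<phi> x = 0)"
proof -
  obtain K where K: "compact K" "\<And>x. x \<notin> K \<Longrightarrow> \<phi> x = 0" using test_function_support[OF assms] by metis
  have "partial_deriv i \<phi> x = 0" if "x \<notin> K" for x i
    by (rule partial_deriv_vanishes[OF compact_imp_closed[OF K(1)] K(2) that])
  then have "grad \<phi> x = 0" if "x \<notin> K" for x using that by (simp add: grad_def vec_eq_iff)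
  then show ?thesis using K(1) by blast
qed

lemma grad_measurable: "\<phi> \<in> test_functions \<Longrightarrow> grad \<phi> \<in> borel_measurable lebesgue"
  by (rule borel_imp_lebesgue_measurable[OF borel_measurable_continuous_onI[OF grad_continuous]])

lemma grad_powr_integrable:
  assumes "\<phi> \<in> test_functions" "0 < p"
  shows "integrable lebesgue (\<lambda>x. norm (grad \<phi> x) powr p)"
proof -
  obtain K where K: "compact K" "\<And>x. x \<notin> K \<Longrightarrow> grad \<phi> x = 0" using grad_vanishes[OF assms(1)] by metis
  have "continuous_on UNIV (\<lambda>x. norm (grad \<phi> x) powr p)"
    using assms(2) by (intro continuous_on_powr' continuous_intros grad_continuous[OF assms(1)]) auto
  then show ?thesis by (rule continuous_compact_support_integrable[OF _ K(1)]) (simp add: K(2))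
qed

lemma nn_integral_grad:
  assumes "\<phi> \<in> test_functions" "0 < p"
  shows "(\<integral>\<^sup>+ x. ennreal (norm (grad \<phi> x) powr p) \<partial>lebesgue) = ennreal (dirichlet p \<phi>)"
  using nn_integral_eq_integral[OF grad_powr_integrable[OF assms]] dirichlet_test_function[OF assms(1)]
  by simp

lemma grad_norm_less_imp:
  assumes "\<phi> \<in> test_functions" "0 < p" "0 < e" "grad_norm p \<phi> < e powr (1 / p)"
  shows "(\<integral>\<^sup>+ x. ennreal (norm (grad \<phi> x) powr p) \<partial>lebesgue) \<le> ennreal e"
proof -
  have "dirichlet p \<phi> powr (1 / p) < e powr (1 / p)"
    using assms by (simp add: grad_norm_def dirichlet_test_function)
  then have "dirichlet p \<phi> < e"
    using assms(2,3) by (meson not_le powr_mono2 less_imp_le zero_le_divide_1_iff)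
  then show ?thesis using assms by (simp add: nn_integral_grad ennreal_leI)
qed

text \<open>Both sides of the integration by parts formula pass to the limit, because convergence in \<open>L\<close> with any
  exponent \<open>\<ge> 1\<close> implies convergence of integrals against bounded functions of compact support.\<close>
lemma is_weak_grad_limit:
  fixes u :: "real^'n \<Rightarrow> real" and \<phi> :: "nat \<Rightarrow> real^'n \<Rightarrow> real"
  assumes \<phi>: "\<And>k. \<phi> k \<in> test_functions" and u: "u \<in> borel_measurable lebesgue"
    and G: "G \<in> borel_measurable lebesgue" and q: "1 \<le> q" and p: "1 \<le> p"
    and lu: "(\<lambda>k. \<integral>\<^sup>+ x. ennreal (\<bar>\<phi> k x - u x\<bar> powr q) \<partial>lebesgue) \<longlonglongrightarrow> 0"
    and lG: "(\<lambda>k. \<integral>\<^sup>+ x. ennreal (norm (grad (\<phi> k) x - G x) powr p) \<partial>lebesgue) \<longlonglongrightarrow> 0"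
  shows "is_weak_grad u G"
proof -
  have fin: "\<exists>k. X k < \<infinity>" if "X \<longlonglongrightarrow> 0" for X :: "nat \<Rightarrow> ennreal"
    using order_tendstoD(2)[OF that, of \<infinity>] by (auto simp: eventually_sequentially)
  have \<phi>m: "\<phi> k \<in> borel_measurable lebesgue" for k
    by (intro borel_imp_lebesgue_measurable test_function_measurable \<phi>)
  obtain k where "(\<integral>\<^sup>+ x. ennreal (\<bar>\<phi> k x - u x\<bar> powr q) \<partial>lebesgue) < \<infinity>" using fin[OF lu] by metis
  then have lu_int: "locally_integrable u"
    by (intro Lq_limit_locally_integrable[OF u continuous_imp_locally_integrable[OF test_function_continuous[OF \<phi>[of k]]] q])
      (simp add: abs_minus_commute)
  obtain k where "(\<integral>\<^sup>+ x. ennreal (norm (grad (\<phi> k) x - G x) powr p) \<partial>lebesgue) < \<infinity>" using fin[OF lG] by metis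
  then have lG_int: "locally_integrable G"
    by (intro Lq_limit_locally_integrable[OF G continuous_imp_locally_integrable[OF grad_continuous[OF \<phi>[of k]]] p])
      (simp add: norm_minus_commute)
  have "(LINT x|lebesgue. u x * partial_deriv i \<psi> x) = - (LINT x|lebesgue. G x $ i * \<psi> x)"
    if \<psi>: "\<psi> \<in> test_functions" for \<psi> i
  proof -
    have d\<psi>: "partial_deriv i \<psi> \<in> test_functions" using \<psi> by (rule test_function_partial_deriv)
    obtain M where M: "M > 0" "\<And>x. \<bar>\<psi> x\<bar> \<le> M" using test_function_bounded[OF \<psi>] by metis
    obtain K where K: "compact K" "\<And>x. x \<notin> K \<Longrightarrow> \<psi> x = 0" using test_function_support[OF \<psi>] by metis
    obtain M' where M': "M' > 0" "\<And>x. \<bar>partial_deriv i \<psi> x\<bar> \<le> M'" using test_function_bounded[OF d\<psi>] by metis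
    obtain K' where K': "compact K'" "\<And>x. x \<notin> K' \<Longrightarrow> partial_deriv i \<psi> x = 0"
      using test_function_support[OF d\<psi>] by metis
    have L: "(\<lambda>k. LINT x|lebesgue. \<phi> k x * partial_deriv i \<psi> x) \<longlonglongrightarrow> (LINT x|lebesgue. u x * partial_deriv i \<psi> x)"
    proof (rule tendsto_L1_int)
      have "(\<lambda>k. \<integral>\<^sup>+ x. ennreal (norm (\<phi> k x - u x) * \<bar>partial_deriv i \<psi> x\<bar>) \<partial>lebesgue) \<longlonglongrightarrow> 0"
        by (rule L1_convergence_from_Lq[OF \<phi>m u q _ K'(1) M'(2) K'(2) M'(1)]) (use lu in simp)
      then show "(\<lambda>k. \<integral>\<^sup>+ x. ennreal (norm (\<phi> k x * partial_deriv i \<psi> x - u x * partial_deriv i \<psi> x)) \<partial>lebesgue) \<longlonglongrightarrow> 0"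
        by (simp add: left_diff_distrib[symmetric] abs_mult)
    qed (use \<phi> d\<psi> lu_int in \<open>auto intro!: integrable_locally_integrable_mult_test
        continuous_imp_locally_integrable test_function_continuous\<close>)
    have R: "(\<lambda>k. LINT x|lebesgue. grad (\<phi> k) x $ i * \<psi> x) \<longlonglongrightarrow> (LINT x|lebesgue. G x $ i * \<psi> x)"
    proof (rule tendsto_L1_int)
      have *: "(\<lambda>k. \<integral>\<^sup>+ x. ennreal (norm (grad (\<phi> k) x - G x) * \<bar>\<psi> x\<bar>) \<partial>lebesgue) \<longlonglongrightarrow> 0"
        by (rule L1_convergence_from_Lq[OF grad_measurable[OF \<phi>] G p lG K(1) M(2) K(2) M(1)])
      show "(\<lambda>k. \<integral>\<^sup>+ x. ennreal (norm (grad (\<phi> k) x $ i * \<psi> x - G x $ i * \<psi> x)) \<partial>lebesgue) \<longlonglongrightarrow> 0"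
      proof (rule tendsto_sandwich[OF _ _ tendsto_const *])
        have "\<bar>(grad (\<phi> k) x - G x) $ i\<bar> * \<bar>\<psi> x\<bar> \<le> norm (grad (\<phi> k) x - G x) * \<bar>\<psi> x\<bar>" for k x
          by (intro mult_right_mono component_le_norm_cart) simp
        then have "norm (grad (\<phi> k) x $ i * \<psi> x - G x $ i * \<psi> x) \<le> norm (grad (\<phi> k) x - G x) * \<bar>\<psi> x\<bar>" for k x
          by (simp add: left_diff_distrib[symmetric] abs_mult)
        then show "eventually (\<lambda>k. (\<integral>\<^sup>+ x. ennreal (norm (grad (\<phi> k) x $ i * \<psi> x - G x $ i * \<psi> x)) \<partial>lebesgue)
            \<le> (\<integral>\<^sup>+ x. ennreal (norm (grad (\<phi> k) x - G x) * \<bar>\<psi> x\<bar>) \<partial>lebesgue)) sequentially"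
          by (intro always_eventually allI nn_integral_mono ennreal_leI)
      qed simp
      have "locally_integrable (grad (\<phi> k))" for k
        by (rule continuous_imp_locally_integrable[OF grad_continuous[OF \<phi>]])
      then show "integrable lebesgue (\<lambda>x. grad (\<phi> k) x $ i * \<psi> x)" for k
        by (intro integrable_locally_integrable_mult_test[OF locally_integrable_component \<psi>])
      show "integrable lebesgue (\<lambda>x. G x $ i * \<psi> x)"
        by (rule integrable_locally_integrable_mult_test[OF locally_integrable_component[OF lG_int] \<psi>])
    qed
    have "(LINT x|lebesgue. \<phi> k x * partial_deriv i \<psi> x) = - (LINT x|lebesgue. grad (\<phi> k) x $ i * \<psi> x)" for k
      using integration_by_parts_test_functions[OF \<phi> \<psi>] by (simp add: grad_def)
    then have "(\<lambda>k. - (LINT x|lebesgue. grad (\<phi> k) x $ i * \<psi> x)) \<longlonglongrightarrow> (LINT x|lebesgue. u x * partial_deriv i \<psi> x)"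
      using L by simp
    from LIMSEQ_unique[OF this tendsto_minus[OF R]] show ?thesis .
  qed
  then show ?thesis unfolding is_weak_grad_def using lu_int lG_int by blast
qed

text \<open>The inequality \<open>powr_sum_le_convex\<close> bounds the energy of \<open>\<phi> k\<close> by \<open>l powr (1 - p)\<close> times that of
  \<open>u\<close> plus a multiple, depending on \<open>l\<close>, of the distance of the gradients. One chooses \<open>l < 1\<close> close
  to \<open>1\<close> first and \<open>k\<close> large afterwards.\<close>
lemma dirichlet_eventually_le:
  fixes \<phi> :: "nat \<Rightarrow> real^'n \<Rightarrow> real"
  assumes \<phi>: "\<And>k. \<phi> k \<in> test_functions" and p: "1 \<le> p"
    and w: "is_weak_grad u G"
    and lG: "(\<lambda>k. \<integral>\<^sup>+ x. ennreal (norm (grad (\<phi> k) x - G x) powr p) \<partial>lebesgue) \<longlonglongrightarrow> 0"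
    and D: "dirichlet p u < D"
  shows "eventually (\<lambda>k. dirichlet p (\<phi> k) \<le> D) sequentially"
proof -
  have G[measurable]: "G \<in> borel_measurable lebesgue" using w by (simp add: is_weak_grad_def locally_integrable_def)
  have gm[measurable]: "grad (\<phi> k) \<in> borel_measurable lebesgue" for k by (rule grad_measurable[OF \<phi>])
  define E where "E k = (\<integral>\<^sup>+ x. ennreal (norm (grad (\<phi> k) x - G x) powr p) \<partial>lebesgue)" for k
  have split: "norm a powr p \<le> l powr (1 - p) * norm b powr p + (1 - l) powr (1 - p) * norm (a - b) powr p"
    if "0 < l" "l < 1" for a b :: "real^'n" and l
  proof -
    have "norm a powr p \<le> (norm b + norm (a - b)) powr p"
      using norm_triangle_ineq[of b "a - b"] p by (intro powr_mono2) auto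
    also have "\<dots> \<le> l powr (1 - p) * norm b powr p + (1 - l) powr (1 - p) * norm (a - b) powr p"
      using that p by (intro powr_sum_le_convex) auto
    finally show ?thesis .
  qed
  have split_int: "(\<integral>\<^sup>+ x. ennreal (norm (f x) powr p) \<partial>lebesgue)
      \<le> ennreal (l powr (1 - p)) * (\<integral>\<^sup>+ x. ennreal (norm (h x) powr p) \<partial>lebesgue)
        + ennreal ((1 - l) powr (1 - p)) * (\<integral>\<^sup>+ x. ennreal (norm (f x - h x) powr p) \<partial>lebesgue)"
    if l: "0 < l" "l < 1" and [measurable]: "f \<in> borel_measurable lebesgue" "h \<in> borel_measurable lebesgue"
    for f h :: "real^'n \<Rightarrow> real^'n" and l
  proof -
    have "(\<integral>\<^sup>+ x. ennreal (norm (f x) powr p) \<partial>lebesgue)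
      \<le> (\<integral>\<^sup>+ x. ennreal (l powr (1 - p)) * ennreal (norm (h x) powr p)
          + ennreal ((1 - l) powr (1 - p)) * ennreal (norm (f x - h x) powr p) \<partial>lebesgue)"
      by (intro nn_integral_mono) (simp add: ennreal_mult'[symmetric] ennreal_plus[symmetric] ennreal_leI split[OF l] del: ennreal_plus)
    also have "\<dots> = ennreal (l powr (1 - p)) * (\<integral>\<^sup>+ x. ennreal (norm (h x) powr p) \<partial>lebesgue)
        + ennreal ((1 - l) powr (1 - p)) * (\<integral>\<^sup>+ x. ennreal (norm (f x - h x) powr p) \<partial>lebesgue)"
      by (simp add: nn_integral_add nn_integral_cmult)
    finally show ?thesis .
  qed
  have "(\<integral>\<^sup>+ x. ennreal (norm (G x) powr p) \<partial>lebesgue) < \<infinity>"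
  proof -
    obtain k where k: "E k \<le> ennreal 1"
      using ennreal_tendsto_0D[OF lG, of 1] unfolding E_def by (auto simp: eventually_sequentially)
    have "(\<integral>\<^sup>+ x. ennreal (norm (G x) powr p) \<partial>lebesgue)
      \<le> ennreal ((1/2) powr (1 - p)) * (\<integral>\<^sup>+ x. ennreal (norm (grad (\<phi> k) x) powr p) \<partial>lebesgue)
        + ennreal ((1 - 1/2) powr (1 - p)) * (\<integral>\<^sup>+ x. ennreal (norm (G x - grad (\<phi> k) x) powr p) \<partial>lebesgue)"
      by (rule split_int) auto
    also have "(\<integral>\<^sup>+ x. ennreal (norm (G x - grad (\<phi> k) x) powr p) \<partial>lebesgue) = E k"
      by (simp add: E_def norm_minus_commute)
    also have "ennreal ((1/2) powr (1 - p)) * (\<integral>\<^sup>+ x. ennreal (norm (grad (\<phi> k) x) powr p) \<partial>lebesgue)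
        + ennreal ((1 - 1/2) powr (1 - p)) * E k < \<infinity>"
      using k nn_integral_grad[OF \<phi>, of p k] p
      by (auto simp: ennreal_mult_less_top less_top[symmetric] top_unique ennreal_mult_eq_top_iff)
    finally show ?thesis .
  qed
  then have "integrable lebesgue (\<lambda>x. norm (G x) powr p)" by (intro integrableI_bounded) auto
  from nn_integral_eq_integral[OF this]
  have Gd: "(\<integral>\<^sup>+ x. ennreal (norm (G x) powr p) \<partial>lebesgue) = ennreal (dirichlet p u)"
    by (simp add: dirichlet_eq[OF w])
  have d0: "0 \<le> dirichlet p u" by (simp add: dirichlet_def)
  \<comment> \<open>The gap between \<open>dirichlet p u\<close> and \<open>D\<close> is shared: up to \<open>D'\<close> for the factor
    \<open>l powr (1 - p)\<close>, and from \<open>D'\<close> to \<open>D\<close> for the error term.\<close>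
  define D' where "D' = (dirichlet p u + D) / 2"
  have D': "dirichlet p u < D'" "D' < D" using D by (auto simp: D'_def)
  have "((\<lambda>l. l powr (1 - p) * dirichlet p u) \<longlongrightarrow> 1 powr (1 - p) * dirichlet p u) (at_left 1)"
    by (intro tendsto_intros) auto
  then have "eventually (\<lambda>l. l powr (1 - p) * dirichlet p u < D') (at_left 1)"
    using D'(1) by (intro order_tendstoD(2)) simp_all
  moreover have "eventually (\<lambda>l::real. l \<in> {0<..<1}) (at_left 1)"
    by (rule eventually_at_left_real) simp
  ultimately have "eventually (\<lambda>l. l powr (1 - p) * dirichlet p u < D' \<and> l \<in> {0<..<1}) (at_left 1)"
    by (rule eventually_conj)
  then obtain l where l: "l powr (1 - p) * dirichlet p u < D'" "0 < l" "l < 1"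
    using eventually_happens[of _ "at_left (1::real)"] by auto
  define c where "c = (1 - l) powr (1 - p)"
  have c: "c > 0" using l by (simp add: c_def)
  have "eventually (\<lambda>k. E k \<le> ennreal ((D - D') / c)) sequentially"
    using ennreal_tendsto_0D[OF lG, of "(D - D') / c"] D' c unfolding E_def by simp
  then show ?thesis
  proof eventually_elim
    case (elim k)
    have "ennreal (dirichlet p (\<phi> k)) \<le> ennreal (l powr (1 - p)) * ennreal (dirichlet p u) + ennreal c * E k"
      using split_int[OF l(2,3) gm G, of k] p by (simp add: nn_integral_grad[OF \<phi>] Gd E_def c_def)
    also have "\<dots> \<le> ennreal (l powr (1 - p)) * ennreal (dirichlet p u) + ennreal c * ennreal ((D - D') / c)"
      using elim by (intro add_mono mult_left_mono) auto
    also have "\<dots> = ennreal (l powr (1 - p) * dirichlet p u + (D - D'))"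
      using c d0 D' by (simp add: ennreal_mult'[symmetric] ennreal_plus[symmetric] del: ennreal_plus)
    also have "\<dots> \<le> ennreal D" using l by (intro ennreal_leI) simp
    finally show ?case using D d0 by simp
  qed
qed

lemma sobolev_exponent_ge_1:
  assumes "1 < p" "p < real N" shows "1 \<le> sobolev_exponent N p"
proof -
  have "real N - p \<le> real N * p" using assms mult_left_mono[of 1 p "real N"] by linarith
  then show ?thesis using assms by (simp add: sobolev_exponent_def)
qed

text \<open>This is all that the main argument needs to know about the Beppo-Levi space: its elements are almost
  everywhere limits of test functions whose energies do not exceed that of \<open>u\<close> in the limit.\<close>
lemma beppo_levi_approximation:
  fixes u :: "real^'n \<Rightarrow> real"
  assumes u: "u \<in> beppo_levi p" and p: "1 < p" "p < real CARD('n)"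
  obtains \<phi> where "\<And>k. \<phi> k \<in> test_functions" "AE x in lebesgue. (\<lambda>k. \<phi> k x) \<longlonglongrightarrow> u x"
    "\<And>D. dirichlet p u < D \<Longrightarrow> eventually (\<lambda>k. dirichlet p (\<phi> k) \<le> D) sequentially"
proof -
  let ?q = "sobolev_exponent CARD('n) p"
  have q: "1 \<le> ?q" using p by (rule sobolev_exponent_ge_1)
  have um[measurable]: "u \<in> borel_measurable lebesgue" using u by (simp add: beppo_levi_def)
  obtain \<phi> where \<phi>: "\<And>k. \<phi> k \<in> test_functions"
    and cauchy: "\<And>e. e > 0 \<Longrightarrow> \<exists>K. \<forall>m\<ge>K. \<forall>n\<ge>K. grad_norm p (\<lambda>x. \<phi> m x - \<phi> n x) < e"
    and lu: "(\<lambda>k. \<integral>\<^sup>+ x. ennreal (\<bar>\<phi> k x - u x\<bar> powr ?q) \<partial>lebesgue) \<longlonglongrightarrow> 0"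
    using u unfolding beppo_levi_def by auto
  have \<phi>m[measurable]: "\<phi> k \<in> borel_measurable lebesgue" for k
    by (intro borel_imp_lebesgue_measurable test_function_measurable \<phi>)
  have grad_cauchy: "\<exists>K. \<forall>m\<ge>K. \<forall>n\<ge>K. (\<integral>\<^sup>+ x. ennreal (norm (grad (\<phi> m) x - grad (\<phi> n) x) powr p) \<partial>lebesgue) \<le> ennreal e"
    if e: "e > 0" for e
  proof -
    obtain K where K: "\<And>m n. m \<ge> K \<Longrightarrow> n \<ge> K \<Longrightarrow> grad_norm p (\<lambda>x. \<phi> m x - \<phi> n x) < e powr (1 / p)"
      using cauchy[of "e powr (1 / p)"] e by auto
    have "(\<integral>\<^sup>+ x. ennreal (norm (grad (\<phi> m) x - grad (\<phi> n) x) powr p) \<partial>lebesgue) \<le> ennreal e"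
      if "m \<ge> K" "n \<ge> K" for m n
      using grad_norm_less_imp[OF test_function_diff[OF \<phi> \<phi>] _ e K[OF that]] p by (simp add: grad_diff[OF \<phi> \<phi>])
    then show ?thesis by blast
  qed
  have "0 < p" using p by simp
  from Lp_complete[OF grad_measurable[OF \<phi>] this grad_cauchy]
  obtain G where G: "G \<in> borel_measurable lebesgue"
    and lG: "(\<lambda>k. \<integral>\<^sup>+ x. ennreal (norm (grad (\<phi> k) x - G x) powr p) \<partial>lebesgue) \<longlonglongrightarrow> 0"
    by auto
  have w: "is_weak_grad u G"
    using is_weak_grad_limit[OF \<phi> um G q _ lu lG] p by simp
  have ev: "eventually (\<lambda>k. dirichlet p (\<phi> k) \<le> D) sequentially" if "dirichlet p u < D" for D
    using dirichlet_eventually_le[OF \<phi> _ w lG that] p by simp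
  \<comment> \<open>Dropping finitely many terms makes the differences integrable with exponent \<open>?q\<close>, so that almost
    everywhere convergence holds along a subsequence.\<close>
  obtain k0 where k0: "\<And>k. k \<ge> k0 \<Longrightarrow> (\<integral>\<^sup>+ x. ennreal (\<bar>\<phi> k x - u x\<bar> powr ?q) \<partial>lebesgue) \<le> ennreal 1"
    using ennreal_tendsto_0D[OF lu, of 1] by (auto simp: eventually_sequentially)
  define v where "v k x = \<bar>\<phi> (k + k0) x - u x\<bar> powr ?q" for k x
  have v0: "0 \<le> v k x" for k x by (simp add: v_def)
  have vint: "integrable lebesgue (v k)" for k
    unfolding v_def using k0[of "k + k0"] by (intro integrableI_bounded) (auto simp: le_less_trans)
  have "(\<lambda>k. LINT x|lebesgue. norm (v k x)) \<longlonglongrightarrow> 0"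
  proof -
    have "(\<integral>\<^sup>+ x. ennreal (v k x) \<partial>lebesgue) = ennreal (LINT x|lebesgue. norm (v k x))" for k
      using nn_integral_eq_integral[OF vint[of k]] v0 by simp
    then have "(\<lambda>k. ennreal (LINT x|lebesgue. norm (v k x))) \<longlonglongrightarrow> 0"
      using LIMSEQ_ignore_initial_segment[OF lu, of k0] by (simp add: v_def)
    then show ?thesis by (subst (asm) ennreal_tendsto_0_iff) (auto intro!: integral_nonneg_AE)
  qed
  from tendsto_L1_AE_subseq[OF vint this] obtain r where r: "strict_mono r"
    "AE x in lebesgue. (\<lambda>k. v (r k) x) \<longlonglongrightarrow> 0" by auto
  have "AE x in lebesgue. (\<lambda>k. \<phi> (r k + k0) x) \<longlonglongrightarrow> u x"
    using r(2)
  proof (rule AE_mp, intro AE_I2 impI)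
    fix x assume "(\<lambda>k. v (r k) x) \<longlonglongrightarrow> 0"
    then have "(\<lambda>k. v (r k) x powr (1 / ?q)) \<longlonglongrightarrow> 0 powr (1 / ?q)"
      using q by (intro tendsto_powr'[OF _ tendsto_const]) (auto simp: v_def)
    moreover have "v k x powr (1 / ?q) = \<bar>\<phi> (k + k0) x - u x\<bar>" for k using q by (simp add: v_def powr_powr)
    ultimately have "(\<lambda>k. \<phi> (r k + k0) x - u x) \<longlonglongrightarrow> 0" using q by (simp add: tendsto_rabs_zero_iff)
    then show "(\<lambda>k. \<phi> (r k + k0) x) \<longlonglongrightarrow> u x" by (rule LIM_zero_cancel)
  qed
  moreover have "eventually (\<lambda>k. dirichlet p (\<phi> (r k + k0)) \<le> D) sequentially" if "dirichlet p u < D" for D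
  proof -
    have "filterlim (\<lambda>k. r k + k0) sequentially sequentially"
      using r(1) by (intro filterlim_subseq) (simp add: strict_mono_def)
    from eventually_compose_filterlim[OF ev[OF that] this] show ?thesis .
  qed
  ultimately show thesis using \<phi> by (intro that[of "\<lambda>k. \<phi> (r k + k0)"])
qed

section \<open>A power inequality for decreasing functions\<close>

lemma powr_tangent_le:
  fixes x y q :: real
  assumes "0 \<le> x" "x \<le> y" "1 < q"
  shows "q * x powr (q - 1) * (y - x) \<le> y powr q - x powr q"
proof (cases "x = 0 \<or> x = y")
  case False
  then have xy: "0 < x" "x < y" using assms by auto
  have "\<exists>z. x < z \<and> z < y \<and> y powr q - x powr q = (y - x) * (q * z powr (q - 1))"
    using xy by (intro MVT2) (auto intro!: derivative_eq_intros simp: powr_diff field_simps)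
  then obtain z where z: "x < z" "y powr q - x powr q = (y - x) * (q * z powr (q - 1))" by auto
  have "q * x powr (q - 1) \<le> q * z powr (q - 1)"
    using xy z(1) assms by (intro mult_left_mono powr_mono2) auto
  from mult_right_mono[OF this, of "y - x"] show ?thesis using z(2) xy by (simp add: mult.commute)
qed (use assms in auto)

lemma indicator_Ioc_split:
  fixes a b c x :: real
  assumes "a \<le> b" "b \<le> c"
  shows "indicator {a<..c} x = (indicator {a<..b} x + indicator {b<..c} x :: ennreal)"
  using assms by (auto simp: indicator_def)

text \<open>For a decreasing \<open>c\<close> and \<open>S T\<close> the integral of \<open>c\<close> over \<open>(0, T]\<close> one has \<open>T * c T \<le> S T\<close>.
  Hence \<open>q * T powr (q - 1) * c T powr q \<le> q * S T powr (q - 1) * c T\<close>, and the right-hand side is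
  formally the derivative of \<open>S T powr q\<close>. As \<open>c\<close> may have infinitely many jumps, the derivative is
  replaced by differences over the intervals \<open>(T, \<rho> * T]\<close> of a geometric partition, at the cost of a
  factor \<open>\<rho> powr (q - 1)\<close>, which disappears as \<open>\<rho>\<close> decreases to \<open>1\<close>.\<close>
lemma antimono_powr_integral_le:
  fixes c :: "real \<Rightarrow> real" and q A :: real
  assumes c[measurable]: "c \<in> borel_measurable borel"
    and c0: "\<And>t. 0 < t \<Longrightarrow> 0 \<le> c t" and anti: "\<And>s t. 0 < s \<Longrightarrow> s \<le> t \<Longrightarrow> c t \<le> c s"
    and q: "1 < q" and A: "0 \<le> A" "(\<integral>\<^sup>+ t. ennreal (c t) * indicator {0<..} t \<partial>lborel) \<le> ennreal A"
  shows "(\<integral>\<^sup>+ t. ennreal (q * t powr (q - 1) * c t powr q) * indicator {0<..} t \<partial>lborel) \<le> ennreal (A powr q)"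
proof -
  let ?f = "\<lambda>t. ennreal (q * t powr (q - 1) * c t powr q)"
  define I where "I T = (\<integral>\<^sup>+ t. ennreal (c t) * indicator {0<..T} t \<partial>lborel)" for T
  have I_le: "I T \<le> ennreal A" for T
  proof -
    have "I T \<le> (\<integral>\<^sup>+ t. ennreal (c t) * indicator {0<..} t \<partial>lborel)"
      unfolding I_def by (intro nn_integral_mono) (auto simp: indicator_def)
    with A(2) show ?thesis by simp
  qed
  define S where "S T = enn2real (I T)" for T
  have IS: "I T = ennreal (S T)" for T
    using I_le[of T] unfolding S_def by (simp add: le_less_trans)
  have S0: "0 \<le> S T" for T by (simp add: S_def)
  have SA: "S T \<le> A" for T using I_le[of T] A(1) by (simp add: IS)
  have S_ge: "T * c T \<le> S T" if T: "0 < T" for T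
  proof -
    have "ennreal (T * c T) = (\<integral>\<^sup>+ t. ennreal (c T) * indicator {0<..T} t \<partial>lborel)"
      using T c0[OF T] by (simp add: nn_integral_cmult_indicator ennreal_mult' mult.commute)
    also have "\<dots> \<le> I T"
      unfolding I_def using anti by (intro nn_integral_mono) (auto simp: indicator_def intro!: ennreal_leI)
    finally show ?thesis using S0[of T] by (simp add: IS)
  qed
  have step: "(\<integral>\<^sup>+ t. ?f t * indicator {T<..\<rho> * T} t \<partial>lborel) \<le> ennreal (\<rho> powr (q - 1) * (S (\<rho> * T) powr q - S T powr q))"
    if T: "0 < T" and \<rho>: "1 < \<rho>" for T \<rho>
  proof -
    have TT: "T \<le> \<rho> * T" using mult_right_mono[of 1 \<rho> T] T \<rho> by linarith
    define J where "J = (\<integral>\<^sup>+ t. ennreal (c t) * indicator {T<..\<rho> * T} t \<partial>lborel)"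
    have "I (\<rho> * T) = (\<integral>\<^sup>+ t. ennreal (c t) * indicator {0<..T} t + ennreal (c t) * indicator {T<..\<rho> * T} t \<partial>lborel)"
      unfolding I_def using T by (simp add: indicator_Ioc_split[OF less_imp_le[OF T] TT] distrib_left)
    also have "\<dots> = I T + J" unfolding I_def J_def by (rule nn_integral_add) measurable
    finally have IJ: "ennreal (S (\<rho> * T)) = ennreal (S T) + J" by (simp add: IS)
    then have "J \<noteq> \<infinity>" by (metis ennreal_add_eq_top ennreal_neq_top infinity_ennreal_def)
    then obtain j where j: "0 \<le> j" "J = ennreal j" by (cases J) auto
    then have Sj: "S (\<rho> * T) = S T + j" using IJ S0 by (simp add: ennreal_plus[symmetric] del: ennreal_plus)
    \<comment> \<open>For \<open>t\<close> in the interval, \<open>t * c t \<le> \<rho> * T * c T \<le> \<rho> * S T\<close>.\<close>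
    define m where "m = q * (\<rho> * S T) powr (q - 1)"
    have m0: "0 \<le> m" using q by (simp add: m_def)
    have pt: "q * t powr (q - 1) * c t powr q \<le> m * c t" if t: "T < t" "t \<le> \<rho> * T" for t
    proof -
      have t0: "0 < t" "0 \<le> c t" using t T c0 by auto
      have "t * c t \<le> (\<rho> * T) * c T"
        using t t0 anti[of T t] T by (intro mult_mono) auto
      also have "\<dots> \<le> \<rho> * S T" using S_ge[OF T] \<rho> by (simp add: mult.assoc)
      finally have "(t * c t) powr (q - 1) \<le> (\<rho> * S T) powr (q - 1)"
        using t0 q by (intro powr_mono2) auto
      then have "q * (t * c t) powr (q - 1) * c t \<le> m * c t"
        unfolding m_def using t0 q by (intro mult_right_mono mult_left_mono) auto
      moreover have "c t powr q = c t * c t powr (q - 1)" using powr_mult_base[OF t0(2), of "q - 1"] by simp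
      ultimately show ?thesis using t0 by (simp add: powr_mult mult_ac)
    qed
    have "(\<integral>\<^sup>+ t. ?f t * indicator {T<..\<rho> * T} t \<partial>lborel)
        \<le> (\<integral>\<^sup>+ t. ennreal m * (ennreal (c t) * indicator {T<..\<rho> * T} t) \<partial>lborel)"
      using pt m0 by (intro nn_integral_mono) (auto simp: indicator_def ennreal_mult'[symmetric] intro!: ennreal_leI)
    also have "\<dots> = ennreal m * J" unfolding J_def by (rule nn_integral_cmult) measurable
    also have "\<dots> = ennreal (m * j)" using j m0 by (simp add: ennreal_mult)
    also have "m * j \<le> \<rho> powr (q - 1) * (S (\<rho> * T) powr q - S T powr q)"
    proof -
      have "q * S T powr (q - 1) * (S (\<rho> * T) - S T) \<le> S (\<rho> * T) powr q - S T powr q"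
        using Sj j S0 q by (intro powr_tangent_le) auto
      then have "\<rho> powr (q - 1) * (q * S T powr (q - 1) * j) \<le> \<rho> powr (q - 1) * (S (\<rho> * T) powr q - S T powr q)"
        using Sj by (intro mult_left_mono) auto
      then show ?thesis using \<rho> S0[of T] by (simp add: m_def powr_mult mult_ac)
    qed
    finally show ?thesis by (simp add: ennreal_leI)
  qed
  have fm[measurable]: "?f \<in> borel_measurable borel" by measurable
  have steps: "(\<integral>\<^sup>+ t. ?f t * indicator {T<..T * \<rho> ^ n} t \<partial>lborel) \<le> ennreal (\<rho> powr (q - 1) * (S (T * \<rho> ^ n) powr q - S T powr q))"
    if T: "0 < T" and \<rho>: "1 < \<rho>" for T \<rho> n
  proof -
    have mono: "S x \<le> S y" if "x \<le> y" for x y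
    proof -
      have "I x \<le> I y" unfolding I_def using that by (intro nn_integral_mono) (auto simp: indicator_def)
      then show ?thesis using S0 by (simp add: IS)
    qed
    have pos: "0 < T * \<rho> ^ k" "T \<le> T * \<rho> ^ k" for k using T \<rho> by simp_all
    show "(\<integral>\<^sup>+ t. ?f t * indicator {T<..T * \<rho> ^ n} t \<partial>lborel) \<le> ennreal (\<rho> powr (q - 1) * (S (T * \<rho> ^ n) powr q - S T powr q))"
    proof (induction n)
      case (Suc n)
      let ?T = "T * \<rho> ^ n"
      have eq: "T * \<rho> ^ Suc n = \<rho> * ?T" by simp
      have le: "?T \<le> \<rho> * ?T" using mult_right_mono[of 1 \<rho> ?T] pos(1)[of n] \<rho> by linarith
      have "(\<integral>\<^sup>+ t. ?f t * indicator {T<..\<rho> * ?T} t \<partial>lborel)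
        = (\<integral>\<^sup>+ t. ?f t * indicator {T<..?T} t + ?f t * indicator {?T<..\<rho> * ?T} t \<partial>lborel)"
        by (simp add: indicator_Ioc_split[OF pos(2)[of n] le] distrib_left)
      also have "\<dots> = (\<integral>\<^sup>+ t. ?f t * indicator {T<..?T} t \<partial>lborel) + (\<integral>\<^sup>+ t. ?f t * indicator {?T<..\<rho> * ?T} t \<partial>lborel)"
        by (rule nn_integral_add) measurable
      also have "\<dots> \<le> ennreal (\<rho> powr (q - 1) * (S ?T powr q - S T powr q))
          + ennreal (\<rho> powr (q - 1) * (S (\<rho> * ?T) powr q - S ?T powr q))"
        by (intro add_mono Suc step pos \<rho>)
      also have "\<dots> = ennreal (\<rho> powr (q - 1) * (S ?T powr q - S T powr q) + \<rho> powr (q - 1) * (S (\<rho> * ?T) powr q - S ?T powr q))"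
        using mono[OF pos(2)[of n]] mono[OF le] S0 q by (intro ennreal_plus[symmetric] mult_nonneg_nonneg) (auto intro: powr_mono2)
      finally show ?case by (simp add: eq algebra_simps)
    qed simp
  qed
  have bound: "(\<integral>\<^sup>+ t. ?f t * indicator {0<..} t \<partial>lborel) \<le> ennreal (\<rho> powr (q - 1) * A powr q)" if \<rho>: "1 < \<rho>" for \<rho>
  proof (rule nn_integral_fatou_bound[where f = "\<lambda>n t. ?f t * indicator {inverse (\<rho> ^ n)<..inverse (\<rho> ^ n) * \<rho> ^ (2 * n)} t"])
    \<comment> \<open>The intervals \<open>(\<rho> ^ - n, \<rho> ^ n]\<close> exhaust the half-line.\<close>
    have conv: "(\<lambda>n. indicator {inverse (\<rho> ^ n)<..inverse (\<rho> ^ n) * \<rho> ^ (2 * n)} t) \<longlonglongrightarrow> (indicator {0<..} t :: ennreal)" for t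
    proof (cases "0 < t")
      case True
      obtain N where "max t (2 / t) < \<rho> ^ N" using real_arch_pow[OF \<rho>] by metis
      moreover have "\<rho> ^ N \<le> \<rho> ^ n" if "N \<le> n" for n using that \<rho> by (intro power_increasing) auto
      ultimately have "\<forall>n\<ge>N. max t (2 / t) \<le> \<rho> ^ n" by fastforce
      then have "eventually (\<lambda>n. max t (2 / t) \<le> \<rho> ^ n) sequentially" by (auto simp: eventually_sequentially)
      then have "eventually (\<lambda>n. indicator {inverse (\<rho> ^ n)<..inverse (\<rho> ^ n) * \<rho> ^ (2 * n)} t = (indicator {0<..} t :: ennreal)) sequentially"
      proof eventually_elim
        case (elim n)
        have inv2: "inverse x * (x * x) = x" if "0 < x" for x :: real using that by (simp add: field_simps)
        have "\<rho> ^ n > 0" using \<rho> by simp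
        then have "inverse (\<rho> ^ n) < t" using elim True by (simp add: field_simps)
        moreover have "inverse (\<rho> ^ n) * \<rho> ^ (2 * n) = \<rho> ^ n"
          using inv2[OF \<open>\<rho> ^ n > 0\<close>] by (simp add: mult_2 power_add)
        ultimately show ?case using elim True by (simp add: indicator_def)
      qed
      then show ?thesis by (rule tendsto_eventually)
    next
      case False
      have "inverse (\<rho> ^ n) > 0" for n using \<rho> by simp
      then have "indicator {inverse (\<rho> ^ n)<..inverse (\<rho> ^ n) * \<rho> ^ (2 * n)} t = (0 :: ennreal)" for n
        using False by (smt (verit) greaterThanAtMost_iff indicator_simps(2))
      then show ?thesis using False by simp
    qed
    show "AE t in lborel. (\<lambda>n. ?f t * indicator {inverse (\<rho> ^ n)<..inverse (\<rho> ^ n) * \<rho> ^ (2 * n)} t) \<longlonglongrightarrow> ?f t * indicator {0<..} t"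
      by (intro AE_I2 tendsto_mult_ennreal tendsto_const conv) (auto simp: indicator_def)
    show "\<forall>\<^sub>F n in sequentially. (\<integral>\<^sup>+ t. ?f t * indicator {inverse (\<rho> ^ n)<..inverse (\<rho> ^ n) * \<rho> ^ (2 * n)} t \<partial>lborel)
        \<le> ennreal (\<rho> powr (q - 1) * A powr q)"
    proof (intro always_eventually allI)
      fix n
      let ?T = "inverse (\<rho> ^ n)"
      have T: "0 < ?T" using \<rho> by simp
      have "S (?T * \<rho> ^ (2 * n)) powr q - S ?T powr q \<le> A powr q"
        using SA S0 q by (smt (verit) powr_ge_zero powr_mono2)
      then have "\<rho> powr (q - 1) * (S (?T * \<rho> ^ (2 * n)) powr q - S ?T powr q) \<le> \<rho> powr (q - 1) * A powr q"
        by (intro mult_left_mono) auto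
      with steps[OF T \<rho>, of "2 * n"]
      show "(\<integral>\<^sup>+ t. ?f t * indicator {?T<..?T * \<rho> ^ (2 * n)} t \<partial>lborel) \<le> ennreal (\<rho> powr (q - 1) * A powr q)"
        using ennreal_leI order_trans by blast
    qed
  qed measurable
  show ?thesis
  proof (rule tendsto_lowerbound)
    have "((\<lambda>\<rho>. \<rho> powr (q - 1) * A powr q) \<longlongrightarrow> 1 powr (q - 1) * A powr q) (at_right 1)"
      by (intro tendsto_intros) auto
    then show "((\<lambda>\<rho>. ennreal (\<rho> powr (q - 1) * A powr q)) \<longlongrightarrow> ennreal (A powr q)) (at_right 1)"
      by (intro tendsto_ennrealI) simp
    show "eventually (\<lambda>\<rho>. (\<integral>\<^sup>+ t. ?f t * indicator {0<..} t \<partial>lborel) \<le> ennreal (\<rho> powr (q - 1) * A powr q)) (at_right (1::real))"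
      using bound by (auto simp: eventually_at_filter)
  qed simp
qed

section \<open>Capacity of superlevel sets\<close>

lemma test_functions_subset_beppo_levi:
  assumes "\<phi> \<in> test_functions" shows "\<phi> \<in> beppo_levi p"
proof -
  have "partial_deriv i (\<lambda>x::real^'a. 0) x = 0" for i x
    by (simp add: partial_deriv_eq[OF has_derivative_const])
  then have "grad (\<lambda>x::real^'a. 0) x = 0" for x by (simp add: grad_def vec_eq_iff)
  then have "grad_norm p (\<lambda>x::real^'a. 0) = 0" by (simp add: grad_norm_def)
  moreover have "\<phi> \<in> borel_measurable lebesgue"
    by (intro borel_imp_lebesgue_measurable test_function_measurable assms)
  ultimately show ?thesis using assms unfolding beppo_levi_def
    by (intro CollectI conjI exI[of _ "\<lambda>k. \<phi>"]) auto
qed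

lemma dirichlet_nonneg: "0 \<le> dirichlet p u"
  by (simp add: dirichlet_def)

lemma capacity_bdd_below: "bdd_below (dirichlet p ` A)"
  using dirichlet_nonneg by (intro bdd_belowI2)

lemma capacity_le_dirichlet:
  assumes "\<phi> \<in> test_functions" "\<And>x. x \<in> F \<Longrightarrow> 1 \<le> \<phi> x"
  shows "capacity p F \<le> dirichlet p \<phi>"
  unfolding capacity_def
  using assms by (intro cINF_lower capacity_bdd_below CollectI conjI test_functions_subset_beppo_levi) auto

text \<open>Some competitor has to exist, since the infimum of the empty set of reals is unspecified. The same
  remark applies to monotonicity below.\<close>
lemma capacity_nonneg:
  assumes "\<phi> \<in> test_functions" "\<And>x. x \<in> F \<Longrightarrow> 1 \<le> \<phi> x"
  shows "0 \<le> capacity p F"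
proof -
  have "\<phi> \<in> {u \<in> beppo_levi p. AE x in lebesgue. x \<in> F \<longrightarrow> 1 \<le> u x}"
    using assms test_functions_subset_beppo_levi by auto
  then show ?thesis unfolding capacity_def by (intro cINF_greatest dirichlet_nonneg) auto
qed

lemma capacity_mono:
  assumes "\<phi> \<in> test_functions" "\<And>x. x \<in> F' \<Longrightarrow> 1 \<le> \<phi> x" "F \<subseteq> F'"
  shows "capacity p F \<le> capacity p F'"
  unfolding capacity_def
proof (rule cINF_superset_mono)
  have "\<phi> \<in> {u \<in> beppo_levi p. AE x in lebesgue. x \<in> F' \<longrightarrow> 1 \<le> u x}"
    using assms test_functions_subset_beppo_levi by auto
  then show "{u \<in> beppo_levi p. AE x in lebesgue. x \<in> F' \<longrightarrow> 1 \<le> u x} \<noteq> {}" by auto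
  show "{u \<in> beppo_levi p. AE x in lebesgue. x \<in> F' \<longrightarrow> 1 \<le> u x}
      \<subseteq> {u \<in> beppo_levi p. AE x in lebesgue. x \<in> F \<longrightarrow> 1 \<le> u x}"
    using assms(3) by (auto elim!: eventually_mono)
qed (auto intro: capacity_bdd_below)

lemma polynomial_antiderivative:
  fixes Q :: "real \<Rightarrow> real"
  assumes "real_polynomial_function Q"
  shows "\<exists>P. real_polynomial_function P \<and> P 0 = 0 \<and> (\<forall>s. (P has_real_derivative Q s) (at s))"
proof -
  obtain c n where Q: "Q = (\<lambda>x. \<Sum>i\<le>n. c i * x ^ i)"
    using assms real_polynomial_function_iff_sum by metis
  define P where "P = (\<lambda>x::real. \<Sum>i\<le>n. (c i / real (Suc i)) * x ^ Suc i)"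
  have "real_polynomial_function P"
    unfolding P_def by (intro real_polynomial_function_sum real_polynomial_function.intros(4)
        real_polynomial_function_power real_polynomial_function.intros(2)
        real_polynomial_function.intros(1)[OF bounded_linear_ident]) simp
  moreover have "(P has_real_derivative Q s) (at s)" for s
  proof -
    have "((\<lambda>x. (c i / real (Suc i)) * x ^ Suc i) has_real_derivative c i * s ^ i) (at s)" for i
      by (rule derivative_eq_intros refl | simp del: of_nat_Suc)+
    then show ?thesis unfolding P_def Q by (intro DERIV_sum)
  qed
  moreover have "P 0 = 0" by (simp add: P_def)
  ultimately show ?thesis by blast
qed

text \<open>If \<open>Q\<close> exceeds the derivative of \<open>(s / t) powr a\<close> up to an error \<open>e\<close> on \<open>[0, t]\<close> and is at least
  \<open>- e\<close> beyond \<open>t\<close>, then \<open>P s + e * s\<close> is at least \<open>1\<close> at \<open>t\<close> and does not decrease up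
  to \<open>M\<close>.\<close>
lemma antiderivative_lower_bound:
  fixes P Q :: "real \<Rightarrow> real"
  assumes P: "\<And>s. (P has_real_derivative Q s) (at s)" "P 0 = 0" and t: "0 < t" "1 < a" and e: "0 \<le> e"
    and low: "\<And>s. 0 < s \<Longrightarrow> s < t \<Longrightarrow> a / t powr a * s powr (a - 1) - e \<le> Q s"
    and high: "\<And>s. t < s \<Longrightarrow> s < M \<Longrightarrow> - e \<le> Q s"
    and s: "t \<le> s" "s \<le> M"
  shows "1 - e * M \<le> P s"
proof -
  have contP: "continuous_on A P" for A
    by (rule DERIV_continuous_on[where D = Q]) (use P(1) in \<open>auto intro: has_field_derivative_at_within\<close>)
  have "P 0 + e * 0 - 0 powr a / t powr a \<le> P t + e * t - t powr a / t powr a"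
  proof (rule DERIV_nonneg_imp_increasing_open[where f = "\<lambda>s. P s + e * s - s powr a / t powr a"])
    show "continuous_on {0..t} (\<lambda>s. P s + e * s - s powr a / t powr a)"
      using t by (intro continuous_intros contP continuous_on_powr') auto
    fix x assume x: "0 < x" "x < t"
    have "((\<lambda>s. s powr a / t powr a) has_real_derivative a / t powr a * x powr (a - 1)) (at x)"
      using DERIV_cdivide[OF has_real_derivative_powr[OF x(1), of a], of "t powr a"] by simp
    then have "((\<lambda>s. P s + e * s - s powr a / t powr a) has_real_derivative Q x + e - a / t powr a * x powr (a - 1)) (at x)"
      by (intro DERIV_diff[OF DERIV_add[OF P(1) DERIV_cmult_Id]])
    then show "\<exists>y. ((\<lambda>s. P s + e * s - s powr a / t powr a) has_real_derivative y) (at x) \<and> 0 \<le> y"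
      using low[OF x] by (intro exI conjI) auto
  qed (use t in simp)
  then have 1: "1 \<le> P t + e * t" using t P(2) by simp
  have "P t + e * t \<le> P s + e * s"
  proof (rule DERIV_nonneg_imp_increasing_open[where f = "\<lambda>s. P s + e * s"])
    show "continuous_on {t..s} (\<lambda>s. P s + e * s)" by (intro continuous_intros contP)
    fix x assume x: "t < x" "x < s"
    have "((\<lambda>s. P s + e * s) has_real_derivative Q x + e) (at x)"
      by (auto intro!: derivative_eq_intros P(1))
    then show "\<exists>y. ((\<lambda>s. P s + e * s) has_real_derivative y) (at x) \<and> 0 \<le> y"
      using high[of x] x s by (intro exI conjI) auto
  qed (rule s)
  moreover have "e * s \<le> e * M" using e s by (intro mult_left_mono)
  ultimately show ?thesis using 1 by linarith
qed

text \<open>The ideal competitor for the superlevel set of \<open>\<bar>\<phi>\<bar>\<close> at height \<open>t\<close> is \<open>min 1 ((\<bar>\<phi>\<bar> / t) powr a)\<close>.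
  This is the derivative of its profile \<open>min 1 ((\<bar>s\<bar> / t) powr a)\<close>, made continuous by a linear ramp of
  width \<open>1 / n\<close> instead of the jump at \<open>t\<close>. The difference of positive and negative parts is
  \<open>sgn s * \<bar>s\<bar> powr (a - 1)\<close>, in a form that is visibly continuous at \<open>0\<close>.\<close>
definition slope :: "real \<Rightarrow> real \<Rightarrow> nat \<Rightarrow> real \<Rightarrow> real" where
  "slope a t n s = a / t powr a * (max s 0 powr (a - 1) - max (- s) 0 powr (a - 1)) *
     max 0 (1 - real n * max 0 (\<bar>s\<bar> - t))"

lemma slope_continuous: "1 < a \<Longrightarrow> continuous_on UNIV (slope a t n)"
  unfolding slope_def[abs_def] by (intro continuous_intros continuous_on_powr') auto

lemma slope_minus: "slope a t n (- s) = - slope a t n s"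
proof -
  have "max (- s) 0 powr (a - 1) - max (- (- s)) 0 powr (a - 1)
      = - (max s 0 powr (a - 1) - max (- s) 0 powr (a - 1))" by simp
  then show ?thesis unfolding slope_def by (simp only: abs_minus_cancel mult_minus_left mult_minus_right)
qed

lemma abs_slope: "1 < a \<Longrightarrow> \<bar>slope a t n s\<bar> = a / t powr a * \<bar>s\<bar> powr (a - 1) * max 0 (1 - real n * max 0 (\<bar>s\<bar> - t))"
  by (cases "0 \<le> s") (auto simp: slope_def abs_mult max_def)

lemma slope_low: "1 < a \<Longrightarrow> 0 < s \<Longrightarrow> s < t \<Longrightarrow> slope a t n s = a / t powr a * s powr (a - 1)"
  by (simp add: slope_def max_def)

lemma slope_nonneg: "1 < a \<Longrightarrow> 0 \<le> s \<Longrightarrow> 0 \<le> slope a t n s"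
  by (simp add: slope_def max_def)

lemma abs_slope_tendsto:
  assumes "1 < a" "0 < t"
  shows "(\<lambda>n. \<bar>slope a t n s\<bar>) \<longlonglongrightarrow> a / t powr a * \<bar>s\<bar> powr (a - 1) * indicator {..t} \<bar>s\<bar>"
proof -
  have "(\<lambda>n. max 0 (1 - real n * max 0 (\<bar>s\<bar> - t))) \<longlonglongrightarrow> indicator {..t} \<bar>s\<bar>"
  proof (cases "\<bar>s\<bar> \<le> t")
    case False
    then obtain N where N: "1 < real N * (\<bar>s\<bar> - t)"
      using reals_Archimedean3[of "\<bar>s\<bar> - t"] by auto
    have "max 0 (1 - real n * max 0 (\<bar>s\<bar> - t)) = 0" if "N \<le> n" for n
    proof -
      have "real N * (\<bar>s\<bar> - t) \<le> real n * (\<bar>s\<bar> - t)" using that False by (intro mult_right_mono) auto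
      moreover have m: "max 0 (\<bar>s\<bar> - t) = \<bar>s\<bar> - t" using False by simp
      ultimately show ?thesis using N unfolding m by (intro max_absorb1) linarith
    qed
    then have "eventually (\<lambda>n. max 0 (1 - real n * max 0 (\<bar>s\<bar> - t)) = indicator {..t} \<bar>s\<bar>) sequentially"
      using False by (auto simp: eventually_sequentially)
    then show ?thesis by (rule tendsto_eventually)
  qed (auto simp: max_def)
  then show ?thesis unfolding abs_slope[OF assms(1)] by (intro tendsto_mult tendsto_const)
qed

text \<open>Weierstrass approximation of the slope, followed by integration, yields polynomial profiles whose
  derivative is uniformly close to the slope on the range of \<open>\<phi>\<close>. The slope is odd, so negative
  arguments are reduced to positive ones by reflection.\<close>
lemma polynomial_truncation:
  assumes a: "1 < a" and t: "0 < t" "t \<le> M" and e: "0 < e"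
  shows "\<exists>P Q. real_polynomial_function P \<and> P 0 = 0 \<and> (\<forall>s. (P has_real_derivative Q s) (at s)) \<and>
    (\<forall>s. t \<le> \<bar>s\<bar> \<longrightarrow> \<bar>s\<bar> \<le> M \<longrightarrow> 1 - e * M \<le> P s) \<and>
    (\<forall>s. \<bar>s\<bar> \<le> M \<longrightarrow> \<bar>\<bar>Q s\<bar> - \<bar>slope a t n s\<bar>\<bar> \<le> e)"
proof -
  obtain Q where Q: "real_polynomial_function Q" "\<And>s. s \<in> {-M..M} \<Longrightarrow> \<bar>slope a t n s - Q s\<bar> < e"
    using Stone_Weierstrass_real_polynomial_function[of "{-M..M}" "slope a t n" e]
      continuous_on_subset[OF slope_continuous[OF a]] e by (metis compact_Icc subset_UNIV)
  obtain P where P: "real_polynomial_function P" "P 0 = 0" "\<And>s. (P has_real_derivative Q s) (at s)"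
    using polynomial_antiderivative[OF Q(1)] by metis
  have pos: "1 - e * M \<le> P s" if "t \<le> s" "s \<le> M" for s
  proof (rule antiderivative_lower_bound[OF P(3,2) t(1) a])
    show "a / t powr a * s powr (a - 1) - e \<le> Q s" if "0 < s" "s < t" for s
      using Q(2)[of s] slope_low[OF a that, of n] that t by auto
    show "- e \<le> Q s" if "t < s" "s < M" for s
      using Q(2)[of s] slope_nonneg[OF a, of s t n] that t by auto
  qed (use that e in auto)
  have neg: "1 - e * M \<le> P (- s)" if "t \<le> s" "s \<le> M" for s
  proof (rule antiderivative_lower_bound[where P = "\<lambda>s. P (- s)" and Q = "\<lambda>s. - Q (- s)", OF _ _ t(1) a])
    show "((\<lambda>s. P (- s)) has_real_derivative - Q (- s)) (at s)" for s
      using DERIV_chain2[OF P(3), of uminus "- 1" s] by (simp add: DERIV_minus[OF DERIV_ident])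
    show "a / t powr a * s powr (a - 1) - e \<le> - Q (- s)" if "0 < s" "s < t" for s
      using Q(2)[of "- s"] slope_low[OF a that, of n] slope_minus[of a t n s] that t by auto
    show "- e \<le> - Q (- s)" if "t < s" "s < M" for s
      using Q(2)[of "- s"] slope_nonneg[OF a, of s t n] slope_minus[of a t n s] that t by auto
  qed (use that e P(2) in auto)
  have "1 - e * M \<le> P s" if "t \<le> \<bar>s\<bar>" "\<bar>s\<bar> \<le> M" for s
    using pos[of s] neg[of "- s"] that by (cases "0 \<le> s") auto
  moreover have "\<bar>\<bar>Q s\<bar> - \<bar>slope a t n s\<bar>\<bar> \<le> e" if "\<bar>s\<bar> \<le> M" for s
  proof -
    have "\<bar>slope a t n s - Q s\<bar> < e" using Q(2)[of s] that by (simp add: abs_le_iff)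
    then show ?thesis using abs_triangle_ineq3[of "Q s" "slope a t n s"] by (simp add: abs_minus_commute)
  qed
  ultimately show ?thesis by (intro exI[of _ P] exI[of _ Q] conjI allI impI P)
qed

lemma grad_polynomial:
  assumes "\<And>s. (P has_real_derivative Q s) (at s)" "\<phi> \<in> test_functions"
  shows "grad (\<lambda>x. P (\<phi> x)) x = Q (\<phi> x) *\<^sub>R grad \<phi> x"
  using partial_deriv_chain(1)[OF assms(1) test_function_differentiable[OF assms(2)]]
  by (simp add: grad_def vec_eq_iff)

text \<open>The right-hand side is the energy of \<open>min 1 ((\<bar>\<phi>\<bar> / t) powr a)\<close>. This function is approximated by
  polynomials of \<open>\<phi>\<close>, rescaled by \<open>\<kappa> n\<close> so that they are at least \<open>1\<close> on the superlevel set; their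
  energies converge by dominated convergence.\<close>
lemma capacity_superlevel_le:
  fixes \<phi> :: "real^'n \<Rightarrow> real"
  assumes \<phi>: "\<phi> \<in> test_functions" and p: "0 < p" and a: "1 < a" and t: "0 < t"
  defines "f \<equiv> \<lambda>x. (a / t powr a * \<bar>\<phi> x\<bar> powr (a - 1) * indicator {..t} \<bar>\<phi> x\<bar> * norm (grad \<phi> x)) powr p"
  shows "capacity p {x. t \<le> \<bar>\<phi> x\<bar>} \<le> (LINT x|lebesgue. f x)" "integrable lebesgue f"
proof -
  obtain M0 where M0: "\<And>x. \<bar>\<phi> x\<bar> \<le> M0" using test_function_bounded[OF \<phi>] by metis
  define M where "M = max M0 t"
  have M: "\<And>x. \<bar>\<phi> x\<bar> \<le> M" "t \<le> M" "0 < M" using M0 t by (auto simp: M_def le_max_iff_disj)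
  \<comment> \<open>The choice keeps \<open>e n * M\<close> below \<open>1 / 2\<close>, so that the rescaling factors stay below \<open>2\<close>.\<close>
  define e where "e n = inverse (real (Suc n)) / (2 * M)" for n
  have e: "0 < e n" "e n * M \<le> 1 / 2" for n
  proof -
    show "0 < e n" using M(3) by (simp add: e_def)
    have "e n * M = inverse (real (Suc n)) / 2" using M(3) by (simp add: e_def)
    moreover have "inverse (real (Suc n)) \<le> 1" by (simp add: field_simps)
    ultimately show "e n * M \<le> 1 / 2" by linarith
  qed
  have e_lim: "e \<longlonglongrightarrow> 0"
    unfolding e_def using tendsto_divide_zero[OF LIMSEQ_inverse_real_of_nat, of "2 * M"] by simp
  have "\<forall>n. \<exists>P Q. real_polynomial_function P \<and> P 0 = 0 \<and> (\<forall>s. (P has_real_derivative Q s) (at s)) \<and>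
    (\<forall>s. t \<le> \<bar>s\<bar> \<longrightarrow> \<bar>s\<bar> \<le> M \<longrightarrow> 1 - e n * M \<le> P s) \<and>
    (\<forall>s. \<bar>s\<bar> \<le> M \<longrightarrow> \<bar>\<bar>Q s\<bar> - \<bar>slope a t n s\<bar>\<bar> \<le> e n)"
    using polynomial_truncation[OF a t M(2) e(1)] by blast
  then obtain P Q where P: "\<And>n. real_polynomial_function (P n)" "\<And>n. P n 0 = 0"
      "\<And>n s. (P n has_real_derivative Q n s) (at s)"
    and P_ge: "\<And>n s. t \<le> \<bar>s\<bar> \<Longrightarrow> \<bar>s\<bar> \<le> M \<Longrightarrow> 1 - e n * M \<le> P n s"
    and Q: "\<And>n s. \<bar>s\<bar> \<le> M \<Longrightarrow> \<bar>\<bar>Q n s\<bar> - \<bar>slope a t n s\<bar>\<bar> \<le> e n" by metis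
  define \<kappa> where "\<kappa> n = 1 - e n * M" for n
  have \<kappa>: "1 / 2 \<le> \<kappa> n" "0 < \<kappa> n" for n using e(2)[of n] by (auto simp: \<kappa>_def)
  define R where "R n s = P n s * (1 / \<kappa> n)" for n s
  define w where "w n x = (\<bar>Q n (\<phi> x)\<bar> * (1 / \<kappa> n) * norm (grad \<phi> x)) powr p" for n x
  have R: "real_polynomial_function (R n)" "R n 0 = 0" "\<And>s. (R n has_real_derivative Q n s * (1 / \<kappa> n)) (at s)" for n
    unfolding R_def
    by (rule real_polynomial_function.intros(4)[OF P(1) real_polynomial_function.intros(2)], simp add: P(2),
        rule DERIV_cmult_right[OF P(3)])
  have Rtest: "(\<lambda>x. R n (\<phi> x)) \<in> test_functions" for n by (rule test_function_polynomial[OF R(1,2) \<phi>])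
  have cap: "capacity p {x. t \<le> \<bar>\<phi> x\<bar>} \<le> (LINT x|lebesgue. w n x)" for n
  proof -
    have "capacity p {x. t \<le> \<bar>\<phi> x\<bar>} \<le> dirichlet p (\<lambda>x. R n (\<phi> x))"
    proof (rule capacity_le_dirichlet[OF Rtest])
      fix x assume "x \<in> {x. t \<le> \<bar>\<phi> x\<bar>}"
      then have "\<kappa> n \<le> P n (\<phi> x)" using P_ge[of "\<phi> x" n] M(1) by (simp add: \<kappa>_def)
      then show "1 \<le> R n (\<phi> x)" using \<kappa>(2)[of n] by (simp add: R_def field_simps)
    qed
    also have "\<dots> = (LINT x|lebesgue. w n x)"
      using \<kappa>(2)[of n] unfolding dirichlet_test_function[OF Rtest] grad_polynomial[OF R(3) \<phi>] w_def
      by (simp add: abs_mult)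
    finally show ?thesis .
  qed
  define B where "B = 2 * (a / t powr a * M powr (a - 1) + 1 / M)"
  have at0: "0 \<le> a / t powr a" using a by simp
  have bound: "\<bar>Q n (\<phi> x)\<bar> * (1 / \<kappa> n) \<le> B" for n x
  proof -
    have "\<bar>slope a t n (\<phi> x)\<bar> \<le> a / t powr a * M powr (a - 1) * 1"
      unfolding abs_slope[OF a] using M(1) a at0
      by (intro mult_mono mult_nonneg_nonneg powr_mono2) auto
    moreover have "e n \<le> 1 / M" using e(2)[of n] M(3) by (simp add: field_simps)
    ultimately have 1: "\<bar>Q n (\<phi> x)\<bar> \<le> a / t powr a * M powr (a - 1) + 1 / M"
      using Q[OF M(1), of n x] by linarith
    have "1 / \<kappa> n \<le> 2" using \<kappa>[of n] by (simp add: field_simps)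
    then have "\<bar>Q n (\<phi> x)\<bar> * (1 / \<kappa> n) \<le> (a / t powr a * M powr (a - 1) + 1 / M) * 2"
      using 1 \<kappa>(2)[of n] by (intro mult_mono) auto
    then show ?thesis unfolding B_def by (simp only: mult.commute[of 2])
  qed
  have B0: "0 \<le> B" using a M(3) by (simp add: B_def)
  have dom: "integrable lebesgue (\<lambda>x. B powr p * norm (grad \<phi> x) powr p)"
    using grad_powr_integrable[OF \<phi> p] by simp
  have lim: "(\<lambda>n. w n x) \<longlonglongrightarrow> f x" for x
  proof -
    have "(\<lambda>n. \<bar>Q n (\<phi> x)\<bar> - \<bar>slope a t n (\<phi> x)\<bar>) \<longlonglongrightarrow> 0"
      by (rule Lim_null_comparison[OF _ e_lim]) (use Q[OF M(1)] in simp)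
    from tendsto_add[OF this abs_slope_tendsto[OF a t, of "\<phi> x"]]
    have 1: "(\<lambda>n. \<bar>Q n (\<phi> x)\<bar>) \<longlonglongrightarrow> a / t powr a * \<bar>\<phi> x\<bar> powr (a - 1) * indicator {..t} \<bar>\<phi> x\<bar>" by simp
    have "\<kappa> \<longlonglongrightarrow> 1 - 0 * M" unfolding \<kappa>_def by (intro tendsto_intros e_lim)
    then have "(\<lambda>n. 1 / \<kappa> n) \<longlonglongrightarrow> 1 / 1" by (intro tendsto_divide tendsto_const) auto
    from tendsto_mult[OF tendsto_mult[OF 1 this] tendsto_const[of "norm (grad \<phi> x)"]]
    have "(\<lambda>n. \<bar>Q n (\<phi> x)\<bar> * (1 / \<kappa> n) * norm (grad \<phi> x))
        \<longlonglongrightarrow> a / t powr a * \<bar>\<phi> x\<bar> powr (a - 1) * indicator {..t} \<bar>\<phi> x\<bar> * norm (grad \<phi> x)" by simp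
    then show ?thesis unfolding w_def f_def using p \<kappa>(2)
      by (intro tendsto_powr'[OF _ tendsto_const]) (auto simp: less_imp_le)
  qed
  have \<phi>m[measurable]: "\<phi> \<in> borel_measurable lebesgue" "grad \<phi> \<in> borel_measurable lebesgue"
    using \<phi> grad_measurable by (auto intro: borel_imp_lebesgue_measurable test_function_measurable)
  have wm: "w n \<in> borel_measurable lebesgue" for n
  proof -
    have "grad (\<lambda>x. R n (\<phi> x)) \<in> borel_measurable lebesgue" by (rule grad_measurable[OF Rtest])
    then have "(\<lambda>x. norm (grad (\<lambda>x. R n (\<phi> x)) x) powr p) \<in> borel_measurable lebesgue" by measurable
    then show ?thesis using \<kappa>(2)[of n] unfolding grad_polynomial[OF R(3) \<phi>] w_def by (simp add: abs_mult)
  qed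
  have fm: "f \<in> borel_measurable lebesgue" unfolding f_def by measurable
  have wb: "AE x in lebesgue. norm (w n x) \<le> B powr p * norm (grad \<phi> x) powr p" for n
  proof (rule AE_I2)
    fix x
    have "w n x \<le> (B * norm (grad \<phi> x)) powr p"
      unfolding w_def using bound p \<kappa>(2)[of n] by (intro powr_mono2 mult_right_mono) auto
    then show "norm (w n x) \<le> B powr p * norm (grad \<phi> x) powr p" using B0 by (simp add: w_def powr_mult)
  qed
  have "(\<lambda>n. LINT x|lebesgue. w n x) \<longlonglongrightarrow> (LINT x|lebesgue. f x)"
    by (rule integral_dominated_convergence[OF fm wm dom _ wb]) (use lim in simp)
  then show "capacity p {x. t \<le> \<bar>\<phi> x\<bar>} \<le> (LINT x|lebesgue. f x)"
    by (rule LIMSEQ_le_const) (use cap in auto)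
  show "integrable lebesgue f"
    by (rule integrable_dominated_convergence[where s = w, OF fm wm dom _ wb]) (use lim in simp)
qed

section \<open>Capacitary inequalities\<close>

lemma sigma_finite_lebesgue: "sigma_finite_measure (lebesgue :: 'a::euclidean_space measure)"
proof
  define A where "A = range (\<lambda>n::nat. cball (0::'a) (real n))"
  have "x \<in> \<Union>A" for x
    using real_arch_simple[of "norm x"] by (auto simp: A_def)
  moreover have "a \<in> lmeasurable" if "a \<in> A" for a
    using that by (auto simp: A_def intro: lmeasurable_compact)
  then have "A \<subseteq> sets lebesgue" "\<forall>a\<in>A. emeasure lebesgue a \<noteq> \<infinity>"
    by (auto simp: fmeasurable_def simp del: emeasure_completion dest: less_imp_neq)
  ultimately show "\<exists>A::'a set set. countable A \<and> A \<subseteq> sets lebesgue \<and> \<Union>A = space lebesgue \<and>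
      (\<forall>a\<in>A. emeasure lebesgue a \<noteq> \<infinity>)"
    by (intro exI[of _ A] conjI) (auto simp: A_def)
qed

lemma tonelli_lborel_lebesgue:
  fixes f :: "real \<Rightarrow> 'a::euclidean_space \<Rightarrow> ennreal"
  assumes "(\<lambda>(t, x). f t x) \<in> borel_measurable (lborel \<Otimes>\<^sub>M lebesgue)"
  shows "(\<integral>\<^sup>+ x. (\<integral>\<^sup>+ t. f t x \<partial>lborel) \<partial>lebesgue) = (\<integral>\<^sup>+ t. (\<integral>\<^sup>+ x. f t x \<partial>lebesgue) \<partial>lborel)"
proof -
  interpret pair_sigma_finite "lborel :: real measure" "lebesgue :: 'a measure"
    unfolding pair_sigma_finite_def by (intro conjI sigma_finite_lborel sigma_finite_lebesgue)
  show ?thesis using assms by (rule Fubini')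
qed

lemma ex_test_function_ge_1_on_superlevel:
  assumes "\<phi> \<in> test_functions" "0 < T" "0 < p"
  shows "\<exists>\<psi>\<in>test_functions. \<forall>x. T \<le> \<bar>\<phi> x\<bar> powr p \<longrightarrow> 1 \<le> \<psi> x"
proof -
  define t where "t = T powr (1 / p)"
  have t: "0 < t" using assms by (simp add: t_def)
  have "real_polynomial_function (\<lambda>s. (s * s) * (1 / (t * t)))"
    by (intro real_polynomial_function.intros(4) real_polynomial_function.intros(2)
        real_polynomial_function.intros(1)[OF bounded_linear_ident])
  from test_function_polynomial[OF this _ assms(1)]
  have "(\<lambda>x. (\<phi> x * \<phi> x) * (1 / (t * t))) \<in> test_functions" by simp
  moreover have "1 \<le> (\<phi> x * \<phi> x) * (1 / (t * t))" if "T \<le> \<bar>\<phi> x\<bar> powr p" for x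
  proof -
    have "t \<le> (\<bar>\<phi> x\<bar> powr p) powr (1 / p)" unfolding t_def using that assms by (intro powr_mono2) auto
    then have "t \<le> \<bar>\<phi> x\<bar>" using assms by (simp add: powr_powr)
    then have "t * t \<le> \<bar>\<phi> x\<bar> * \<bar>\<phi> x\<bar>" using t by (intro mult_mono) auto
    then show ?thesis using t by (simp add: field_simps)
  qed
  ultimately show ?thesis by (intro bexI[of _ "\<lambda>x. (\<phi> x * \<phi> x) * (1 / (t * t))"] allI impI)
qed

lemma le_powr_iff_root_le:
  fixes T y p :: real
  assumes "0 < T" "0 \<le> y" "0 < p"
  shows "T \<le> y powr p \<longleftrightarrow> T powr (1 / p) \<le> y"
proof
  assume "T \<le> y powr p"
  then have "T powr (1 / p) \<le> (y powr p) powr (1 / p)" using assms by (intro powr_mono2) auto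
  then show "T powr (1 / p) \<le> y" using assms by (simp add: powr_powr)
next
  assume "T powr (1 / p) \<le> y"
  then have "(T powr (1 / p)) powr p \<le> y powr p" using assms by (intro powr_mono2) auto
  then show "T \<le> y powr p" using assms by (simp add: powr_powr)
qed

text \<open>Maz'ya's capacitary inequality. The energy bound for the level \<open>T\<close> of \<open>\<bar>\<phi>\<bar> powr p\<close> is the integral
  over \<open>\<bar>\<phi> x\<bar> powr p \<le> T\<close> of
  \<open>a powr p * T powr (- a) * \<bar>\<phi> x\<bar> powr ((a - 1) * p) * norm (grad \<phi> x) powr p\<close>. After Tonelli's theorem,
  integration of \<open>T powr (- a)\<close> from \<open>\<bar>\<phi> x\<bar> powr p\<close> to infinity cancels the power of \<open>\<bar>\<phi> x\<bar>\<close> and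
  leaves the factor \<open>1 / (a - 1)\<close>.\<close>
lemma capacity_strong_type:
  fixes \<phi> :: "real^'n \<Rightarrow> real"
  assumes \<phi>: "\<phi> \<in> test_functions" and p: "0 < p" and a: "1 < a"
  shows "(\<integral>\<^sup>+ T. ennreal (capacity p {x. T \<le> \<bar>\<phi> x\<bar> powr p}) * indicator {0<..} T \<partial>lborel)
    \<le> ennreal (a powr p / (a - 1) * dirichlet p \<phi>)"
proof -
  have [measurable]: "\<phi> \<in> borel_measurable lebesgue" "grad \<phi> \<in> borel_measurable lebesgue"
    using \<phi> grad_measurable by (auto intro: borel_imp_lebesgue_measurable test_function_measurable)
  define s where "s x = \<bar>\<phi> x\<bar> powr p" for x
  define k where "k x = a powr p * \<bar>\<phi> x\<bar> powr ((a - 1) * p) * norm (grad \<phi> x) powr p" for x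
  have [measurable]: "s \<in> borel_measurable lebesgue" "k \<in> borel_measurable lebesgue"
    unfolding s_def k_def by measurable
  have k0: "0 \<le> k x" for x by (simp add: k_def)
  define F where "F T x = ennreal (k x) * (ennreal (T powr (- a)) * (if 0 < T \<and> s x \<le> T then 1 else 0))" for T x
  have cap: "ennreal (capacity p {x. T \<le> \<bar>\<phi> x\<bar> powr p}) * indicator {0<..} T \<le> (\<integral>\<^sup>+ x. F T x \<partial>lebesgue)" for T
  proof (cases "0 < T")
    case T: True
    define t where "t = T powr (1 / p)"
    have t: "0 < t" using T by (simp add: t_def)
    let ?f = "\<lambda>x. (a / t powr a * \<bar>\<phi> x\<bar> powr (a - 1) * indicator {..t} \<bar>\<phi> x\<bar> * norm (grad \<phi> x)) powr p"
    have "{x. T \<le> \<bar>\<phi> x\<bar> powr p} = {x. t \<le> \<bar>\<phi> x\<bar>}" using T p by (simp add: t_def le_powr_iff_root_le)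
    then have "ennreal (capacity p {x. T \<le> \<bar>\<phi> x\<bar> powr p}) \<le> ennreal (LINT x|lebesgue. ?f x)"
      using capacity_superlevel_le(1)[OF \<phi> p a t] by (simp add: ennreal_leI)
    also have "\<dots> = (\<integral>\<^sup>+ x. ennreal (?f x) \<partial>lebesgue)"
      by (rule nn_integral_eq_integral[symmetric, OF capacity_superlevel_le(2)[OF \<phi> p a t]]) simp
    also have "\<dots> \<le> (\<integral>\<^sup>+ x. F T x \<partial>lebesgue)"
    proof (rule nn_integral_mono)
      fix x
      show "ennreal (?f x) \<le> F T x"
      proof (cases "\<bar>\<phi> x\<bar> \<le> t")
        case True
        have "\<bar>\<phi> x\<bar> powr p \<le> t powr p" using True p by (intro powr_mono2) auto
        then have sT: "s x \<le> T" using T p by (simp add: s_def t_def powr_powr)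
        have "(t powr a) powr p = T powr a" using T p by (simp add: t_def powr_powr)
        then have "?f x = k x * T powr (- a)" using True a t
          by (simp add: k_def powr_mult powr_divide powr_powr powr_minus_divide mult.commute mult.left_commute)
        then show ?thesis using sT T k0 by (simp add: F_def ennreal_mult)
      qed simp
    qed
    finally show ?thesis using T by simp
  qed simp
  have inner: "(\<integral>\<^sup>+ T. F T x \<partial>lborel) = ennreal (a powr p / (a - 1)) * ennreal (norm (grad \<phi> x) powr p)"
    if "\<phi> x \<noteq> 0" for x
  proof -
    have s: "0 < s x" using that by (simp add: s_def)
    have hi: "((\<lambda>T. T powr (- a)) has_integral - (s x powr (- a + 1)) / (- a + 1)) {s x..}"
      using a s by (intro has_integral_powr_to_inf) auto
    have "(\<integral>\<^sup>+ T. F T x \<partial>lborel) = (\<integral>\<^sup>+ T. ennreal (k x) * (ennreal (T powr (- a)) * indicator {s x..} T) \<partial>lborel)"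
      unfolding F_def using s by (intro nn_integral_cong) (auto simp: indicator_def)
    also have "\<dots> = ennreal (k x) * (\<integral>\<^sup>+ T. ennreal (T powr (- a)) * indicator {s x..} T \<partial>lborel)"
      by (rule nn_integral_cmult) measurable
    also have "\<dots> = ennreal (k x) * ennreal (- (s x powr (- a + 1)) / (- a + 1))"
      using nn_integral_has_integral_lebesgue'[OF _ hi] by simp
    also have "- (s x powr (- a + 1)) / (- a + 1) = s x powr (1 - a) / (a - 1)"
      using a by (simp add: field_simps)
    also have "ennreal (k x) * ennreal (s x powr (1 - a) / (a - 1)) = ennreal (k x * (s x powr (1 - a) / (a - 1)))"
      using k0 a by (intro ennreal_mult[symmetric]) auto
    also have "k x * (s x powr (1 - a) / (a - 1)) = a powr p / (a - 1) * norm (grad \<phi> x) powr p"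
    proof -
      have "\<bar>\<phi> x\<bar> powr ((a - 1) * p) * s x powr (1 - a) = \<bar>\<phi> x\<bar> powr ((a - 1) * p + p * (1 - a))"
        by (simp add: s_def powr_powr powr_add)
      also have "(a - 1) * p + p * (1 - a) = 0" by (simp add: algebra_simps)
      finally have "\<bar>\<phi> x\<bar> powr ((a - 1) * p) * s x powr (1 - a) = 1" using that by simp
      then have "a powr p * (\<bar>\<phi> x\<bar> powr ((a - 1) * p) * s x powr (1 - a)) * norm (grad \<phi> x) powr p / (a - 1)
          = a powr p * norm (grad \<phi> x) powr p / (a - 1)" by simp
      then show ?thesis by (simp add: k_def mult_ac)
    qed
    also have "ennreal (a powr p / (a - 1) * norm (grad \<phi> x) powr p)
        = ennreal (a powr p / (a - 1)) * ennreal (norm (grad \<phi> x) powr p)"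
      using a by (intro ennreal_mult) auto
    finally show ?thesis .
  qed
  have inner_le: "(\<integral>\<^sup>+ T. F T x \<partial>lborel) \<le> ennreal (a powr p / (a - 1)) * ennreal (norm (grad \<phi> x) powr p)" for x
    using inner[of x] by (cases "\<phi> x = 0") (auto simp: F_def k_def)
  have "(\<integral>\<^sup>+ T. ennreal (capacity p {x. T \<le> \<bar>\<phi> x\<bar> powr p}) * indicator {0<..} T \<partial>lborel)
      \<le> (\<integral>\<^sup>+ T. (\<integral>\<^sup>+ x. F T x \<partial>lebesgue) \<partial>lborel)"
    by (intro nn_integral_mono cap)
  also have "\<dots> = (\<integral>\<^sup>+ x. (\<integral>\<^sup>+ T. F T x \<partial>lborel) \<partial>lebesgue)"
    by (rule tonelli_lborel_lebesgue[symmetric]) (unfold F_def, measurable)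
  also have "\<dots> \<le> (\<integral>\<^sup>+ x. ennreal (a powr p / (a - 1)) * ennreal (norm (grad \<phi> x) powr p) \<partial>lebesgue)"
    by (intro nn_integral_mono inner_le)
  also have "\<dots> = ennreal (a powr p / (a - 1)) * ennreal (dirichlet p \<phi>)"
    by (subst nn_integral_cmult) (auto simp: nn_integral_grad[OF \<phi> p])
  also have "\<dots> = ennreal (a powr p / (a - 1) * dirichlet p \<phi>)"
    using a dirichlet_nonneg by (intro ennreal_mult[symmetric]) auto
  finally show ?thesis .
qed

text \<open>The exponent \<open>a = p / (p - 1)\<close> minimises \<open>a powr p / (a - 1)\<close> over \<open>a > 1\<close>, and \<open>C_H p\<close> is the minimum.\<close>
lemma C_H_eq:
  assumes "1 < p"
  shows "(p / (p - 1)) powr p / (p / (p - 1) - 1) = C_H p"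
proof -
  have "p / (p - 1) - 1 = 1 / (p - 1)" using assms by (simp add: field_simps)
  moreover have "(p - 1) powr (1 - p) = (p - 1) / (p - 1) powr p" using assms by (simp add: powr_diff)
  ultimately show ?thesis using assms by (simp add: C_H_def powr_divide)
qed

text \<open>If the capacity vanishes, finiteness of the norm forces the integral to vanish as well.\<close>
lemma H_norm_bound:
  fixes F :: "(real^'n) set"
  assumes "g \<in> H_space p r" "F \<in> sets lebesgue" "bounded F"
  shows "(\<integral>\<^sup>+ x\<in>F. ennreal \<bar>g x\<bar> \<partial>lebesgue) \<le> H_norm p r g * ennreal (capacity p F powr (r / p))"
proof -
  let ?X = "\<integral>\<^sup>+ x\<in>F. ennreal \<bar>g x\<bar> \<partial>lebesgue" and ?c = "ennreal (capacity p F powr (r / p))"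
  have le: "?X / ?c \<le> H_norm p r g"
    unfolding H_norm_def using assms(2,3) by (intro SUP_upper) (auto simp: compact_closure)
  show ?thesis
  proof (cases "?c = 0")
    case True
    have "?X = 0"
    proof (rule ccontr)
      assume "?X \<noteq> 0"
      then have "?X / ?c = top" unfolding True by (simp add: ennreal_divide_zero)
      with le have "H_norm p r g = top" by (simp add: top_unique)
      then show False using assms(1) by (simp add: H_space_def)
    qed
    then show ?thesis by simp
  next
    case False
    have "?X = ?X * (?c / ?c)" using False by (subst ennreal_divide_self) auto
    also have "\<dots> = ?X / ?c * ?c" by (simp add: ennreal_divide_times)
    also have "\<dots> \<le> H_norm p r g * ?c" using le by (intro mult_right_mono) auto
    finally show ?thesis .
  qed
qed

text \<open>Write \<open>q = r / p\<close> and \<open>c T\<close> for the capacity of the superlevel set of \<open>\<bar>\<phi>\<bar> powr p\<close> at \<open>T\<close>. By the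
  layer cake formula the left-hand side is the integral over \<open>T > 0\<close> of \<open>q * T powr (q - 1)\<close> times the
  integral of \<open>\<bar>g\<bar>\<close> over that superlevel set, which is at most the norm of \<open>g\<close> times \<open>c T powr q\<close>. As
  \<open>c\<close> is decreasing, \<open>antimono_powr_integral_le\<close> reduces the estimate to the integral of \<open>c\<close>, which
  \<open>capacity_strong_type\<close> bounds.\<close>
text \<open>Fatou's lemma along the approximating test functions gives the bound with any \<open>D > dirichlet p u\<close> in
  place of the energy; then \<open>D\<close> decreases to \<open>dirichlet p u\<close>.\<close>
lemma capacitary_inequality_test_function:
  fixes \<phi> g :: "real^'n \<Rightarrow> real"
  assumes \<phi>: "\<phi> \<in> test_functions" and p: "1 < p" "p < r" and g: "g \<in> H_space p r"
  shows "(\<integral>\<^sup>+ x. ennreal (\<bar>g x\<bar> * \<bar>\<phi> x\<bar> powr r) \<partial>lebesgue)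
    \<le> ennreal (enn2real (H_norm p r g) * (C_H p * dirichlet p \<phi>) powr (r / p))"
proof -
  define q where "q = r / p"
  have q: "1 < q" using p by (simp add: q_def)
  define H where "H = enn2real (H_norm p r g)"
  have H: "H_norm p r g = ennreal H" "0 \<le> H" using g by (auto simp: H_def H_space_def)
  have [measurable]: "\<phi> \<in> borel_measurable lebesgue"
    using \<phi> by (intro borel_imp_lebesgue_measurable test_function_measurable)
  have [measurable]: "g \<in> borel_measurable lebesgue" using g by (simp add: H_space_def locally_integrable_def)
  define s where "s x = \<bar>\<phi> x\<bar> powr p" for x
  have [measurable]: "s \<in> borel_measurable lebesgue" unfolding s_def by measurable
  define c where "c T = (if 0 < T then capacity p {x. T \<le> s x} else 0)" for T
  have c0: "0 \<le> c T" for T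
  proof (cases "0 < T")
    case True
    obtain \<psi> where "\<psi> \<in> test_functions" "\<And>x. T \<le> s x \<Longrightarrow> 1 \<le> \<psi> x"
      using ex_test_function_ge_1_on_superlevel[OF \<phi> True, of p] p unfolding s_def by auto
    then show ?thesis using True by (auto simp: c_def intro!: capacity_nonneg)
  qed (simp add: c_def)
  have anti: "c T \<le> c S" if ST: "0 < S" "S \<le> T" for S T
  proof -
    obtain \<psi> where \<psi>: "\<psi> \<in> test_functions" "\<And>x. S \<le> s x \<Longrightarrow> 1 \<le> \<psi> x"
      using ex_test_function_ge_1_on_superlevel[OF \<phi> ST(1), of p] p unfolding s_def by auto
    have "capacity p {x. T \<le> s x} \<le> capacity p {x. S \<le> s x}"
      using \<psi>(2) ST by (intro capacity_mono[OF \<psi>(1)]) auto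
    then show ?thesis using ST by (simp add: c_def)
  qed
  have [measurable]: "c \<in> borel_measurable borel"
  proof -
    \<comment> \<open>In the variable \<open>ln T\<close>, the function \<open>c\<close> is monotone on the whole line.\<close>
    have "mono (\<lambda>y. - c (exp y))" using anti by (intro monoI) auto
    from borel_measurable_uminus[OF borel_measurable_mono[OF this]]
    have [measurable]: "(\<lambda>y. c (exp y)) \<in> borel_measurable borel" by simp
    have "(\<lambda>T. if 0 < T then c (exp (ln T)) else 0) \<in> borel_measurable borel" by measurable
    also have "(\<lambda>T. if 0 < T then c (exp (ln T)) else 0) = c" by (auto simp: c_def fun_eq_iff)
    finally show ?thesis .
  qed
  define A where "A = C_H p * dirichlet p \<phi>"
  have A0: "0 \<le> A" unfolding A_def C_H_def using dirichlet_nonneg by (intro mult_nonneg_nonneg) auto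
  have "(\<integral>\<^sup>+ T. ennreal (c T) * indicator {0<..} T \<partial>lborel)
      = (\<integral>\<^sup>+ T. ennreal (capacity p {x. T \<le> \<bar>\<phi> x\<bar> powr p}) * indicator {0<..} T \<partial>lborel)"
    by (intro nn_integral_cong) (auto simp: c_def s_def indicator_def)
  also have "\<dots> \<le> ennreal A"
    using capacity_strong_type[OF \<phi>, of p "p / (p - 1)"] p unfolding C_H_eq[OF p(1)] A_def by simp
  finally have cA: "(\<integral>\<^sup>+ T. ennreal (q * T powr (q - 1) * c T powr q) * indicator {0<..} T \<partial>lborel) \<le> ennreal (A powr q)"
    by (intro antimono_powr_integral_le c0 anti q A0) auto
  define F where "F T x = ennreal \<bar>g x\<bar> * (ennreal (q * T powr (q - 1)) * (if 0 < T \<and> T \<le> s x then 1 else 0))" for T x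
  obtain K where K: "compact K" "\<And>x. x \<notin> K \<Longrightarrow> \<phi> x = 0" using test_function_support[OF \<phi>] by metis
  have inner: "(\<integral>\<^sup>+ T. F T x \<partial>lborel) = ennreal (\<bar>g x\<bar> * \<bar>\<phi> x\<bar> powr r)" for x
  proof -
    have hi: "((\<lambda>T. q * T powr (q - 1)) has_integral q * (s x powr (q - 1 + 1) / (q - 1 + 1))) {0..s x}"
      using q by (intro has_integral_mult_right has_integral_powr_from_0) (auto simp: s_def)
    have "(\<integral>\<^sup>+ T. F T x \<partial>lborel) = (\<integral>\<^sup>+ T. ennreal \<bar>g x\<bar> * (ennreal (q * T powr (q - 1)) * indicator {0..s x} T) \<partial>lborel)"
      unfolding F_def by (intro nn_integral_cong) (auto simp: indicator_def)
    also have "\<dots> = ennreal \<bar>g x\<bar> * (\<integral>\<^sup>+ T. ennreal (q * T powr (q - 1)) * indicator {0..s x} T \<partial>lborel)"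
      by (rule nn_integral_cmult) measurable
    also have "\<dots> = ennreal \<bar>g x\<bar> * ennreal (q * (s x powr (q - 1 + 1) / (q - 1 + 1)))"
      using nn_integral_has_integral_lebesgue'[OF _ hi] q by simp
    also have "q * (s x powr (q - 1 + 1) / (q - 1 + 1)) = \<bar>\<phi> x\<bar> powr r"
      using q p by (simp add: s_def powr_powr q_def)
    finally show ?thesis by (simp add: ennreal_mult)
  qed
  have outer: "(\<integral>\<^sup>+ x. F T x \<partial>lebesgue) \<le> ennreal H * (ennreal (q * T powr (q - 1) * c T powr q) * indicator {0<..} T)" for T
  proof (cases "0 < T")
    case True
    let ?S = "{x. T \<le> s x}"
    have "{x \<in> space lebesgue. T \<le> s x} \<in> sets lebesgue" by measurable
    then have S: "?S \<in> sets lebesgue" by simp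
    have "?S \<subseteq> K" using K(2) True by (force simp: s_def)
    then have bd: "bounded ?S" using compact_imp_bounded[OF K(1)] bounded_subset by blast
    have "(\<integral>\<^sup>+ x. F T x \<partial>lebesgue) = (\<integral>\<^sup>+ x. ennreal (q * T powr (q - 1)) * (ennreal \<bar>g x\<bar> * indicator ?S x) \<partial>lebesgue)"
      unfolding F_def using True by (intro nn_integral_cong) (auto simp: indicator_def mult.commute)
    also have "\<dots> = ennreal (q * T powr (q - 1)) * (\<integral>\<^sup>+ x\<in>?S. ennreal \<bar>g x\<bar> \<partial>lebesgue)"
      by (rule nn_integral_cmult) (use S in measurable)
    also have "\<dots> \<le> ennreal (q * T powr (q - 1)) * (ennreal H * ennreal (c T powr q))"
      using H_norm_bound[OF g S bd] True unfolding H(1) by (intro mult_left_mono) (simp_all add: c_def q_def)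
    also have "\<dots> = ennreal H * ennreal (q * T powr (q - 1) * c T powr q)"
      using q by (simp add: ennreal_mult mult_ac)
    finally show ?thesis using True by simp
  qed (simp add: F_def)
  have "(\<integral>\<^sup>+ x. ennreal (\<bar>g x\<bar> * \<bar>\<phi> x\<bar> powr r) \<partial>lebesgue) = (\<integral>\<^sup>+ x. (\<integral>\<^sup>+ T. F T x \<partial>lborel) \<partial>lebesgue)"
    unfolding inner ..
  also have "\<dots> = (\<integral>\<^sup>+ T. (\<integral>\<^sup>+ x. F T x \<partial>lebesgue) \<partial>lborel)"
    by (rule tonelli_lborel_lebesgue) (unfold F_def, measurable)
  also have "\<dots> \<le> (\<integral>\<^sup>+ T. ennreal H * (ennreal (q * T powr (q - 1) * c T powr q) * indicator {0<..} T) \<partial>lborel)"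
    by (intro nn_integral_mono outer)
  also have "\<dots> = ennreal H * (\<integral>\<^sup>+ T. ennreal (q * T powr (q - 1) * c T powr q) * indicator {0<..} T \<partial>lborel)"
    by (rule nn_integral_cmult) measurable
  also have "\<dots> \<le> ennreal H * ennreal (A powr q)" using cA by (rule mult_left_mono) simp
  also have "\<dots> = ennreal (H * A powr q)" using H(2) by (simp add: ennreal_mult)
  finally show ?thesis by (simp add: H_def A_def q_def)
qed

text \<open>Fatou's lemma along the approximating test functions gives the bound with any \<open>D > dirichlet p u\<close> in
  place of the energy; then \<open>D\<close> decreases to \<open>dirichlet p u\<close>.\<close>
lemma capacitary_inequality:
  fixes u g :: "real^'n \<Rightarrow> real"
  assumes u: "u \<in> beppo_levi p" and p: "1 < p" "p < real CARD('n)" "p < r" and g: "g \<in> H_space p r"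
  shows "(\<integral>\<^sup>+ x. ennreal (\<bar>g x\<bar> * \<bar>u x\<bar> powr r) \<partial>lebesgue)
    \<le> ennreal (enn2real (H_norm p r g) * (C_H p * dirichlet p u) powr (r / p))"
proof (rule beppo_levi_approximation[OF u p(1,2)])
  fix \<phi> :: "nat \<Rightarrow> real^'n \<Rightarrow> real"
  assume \<phi>: "\<And>k. \<phi> k \<in> test_functions" "AE x in lebesgue. (\<lambda>k. \<phi> k x) \<longlonglongrightarrow> u x"
    "\<And>D. dirichlet p u < D \<Longrightarrow> eventually (\<lambda>k. dirichlet p (\<phi> k) \<le> D) sequentially"
  have [measurable]: "g \<in> borel_measurable lebesgue" using g by (simp add: H_space_def locally_integrable_def)
  have [measurable]: "\<phi> k \<in> borel_measurable lebesgue" for k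
    by (intro borel_imp_lebesgue_measurable test_function_measurable \<phi>)
  define B where "B D = enn2real (H_norm p r g) * (C_H p * D) powr (r / p)" for D
  have C0: "0 \<le> C_H p" by (simp add: C_H_def)
  have bound: "(\<integral>\<^sup>+ x. ennreal (\<bar>g x\<bar> * \<bar>u x\<bar> powr r) \<partial>lebesgue) \<le> ennreal (B D)" if D: "dirichlet p u < D" for D
  proof (rule nn_integral_fatou_bound[where f = "\<lambda>k x. ennreal (\<bar>g x\<bar> * \<bar>\<phi> k x\<bar> powr r)"])
    show "AE x in lebesgue. (\<lambda>k. ennreal (\<bar>g x\<bar> * \<bar>\<phi> k x\<bar> powr r)) \<longlonglongrightarrow> ennreal (\<bar>g x\<bar> * \<bar>u x\<bar> powr r)"
      using \<phi>(2)
    proof (rule AE_mp, intro AE_I2 impI)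
      fix x assume "(\<lambda>k. \<phi> k x) \<longlonglongrightarrow> u x"
      then have "(\<lambda>k. \<bar>\<phi> k x\<bar> powr r) \<longlonglongrightarrow> \<bar>u x\<bar> powr r"
        using p by (intro tendsto_powr'[OF tendsto_rabs tendsto_const]) auto
      then show "(\<lambda>k. ennreal (\<bar>g x\<bar> * \<bar>\<phi> k x\<bar> powr r)) \<longlonglongrightarrow> ennreal (\<bar>g x\<bar> * \<bar>u x\<bar> powr r)"
        by (intro tendsto_ennrealI tendsto_mult tendsto_const)
    qed
    show "\<forall>\<^sub>F k in sequentially. (\<integral>\<^sup>+ x. ennreal (\<bar>g x\<bar> * \<bar>\<phi> k x\<bar> powr r) \<partial>lebesgue) \<le> ennreal (B D)"
      using \<phi>(3)[OF D]
    proof eventually_elim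
      case (elim k)
      have "B (dirichlet p (\<phi> k)) \<le> B D"
        unfolding B_def using elim p C0 dirichlet_nonneg
        by (intro mult_left_mono powr_mono2 mult_nonneg_nonneg) auto
      then show ?case
        using capacitary_inequality_test_function[OF \<phi>(1) p(1,3) g, of k] unfolding B_def
        by (meson ennreal_leI order_trans)
    qed
  qed measurable
  have "(\<integral>\<^sup>+ x. ennreal (\<bar>g x\<bar> * \<bar>u x\<bar> powr r) \<partial>lebesgue) \<le> ennreal (B (dirichlet p u))"
  proof (rule tendsto_lowerbound)
    have "((\<lambda>D. C_H p * D) \<longlongrightarrow> C_H p * dirichlet p u) (at_right (dirichlet p u))"
      by (intro tendsto_intros)
    then have "((\<lambda>D. (C_H p * D) powr (r / p)) \<longlongrightarrow> (C_H p * dirichlet p u) powr (r / p)) (at_right (dirichlet p u))"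
      using p C0 dirichlet_nonneg[of p u]
      by (intro tendsto_powr'[OF _ tendsto_const]) (auto simp: eventually_at_filter)
    then show "((\<lambda>D. ennreal (B D)) \<longlongrightarrow> ennreal (B (dirichlet p u))) (at_right (dirichlet p u))"
      unfolding B_def by (intro tendsto_ennrealI tendsto_mult tendsto_const)
    show "eventually (\<lambda>D. (\<integral>\<^sup>+ x. ennreal (\<bar>g x\<bar> * \<bar>u x\<bar> powr r) \<partial>lebesgue) \<le> ennreal (B D)) (at_right (dirichlet p u))"
      using bound by (auto simp: eventually_at_filter)
  qed simp
  then show ?thesis by (simp add: B_def)
qed

section \<open>The logarithmic inequality\<close>

text \<open>The positive part of \<open>f\<close> has finite integral. If that of the negative part is infinite, the
  left-hand side is \<open>-\<infinity>\<close>; otherwise \<open>f\<close> is integrable.\<close>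
lemma ext_integral_le_integral:
  fixes f Z :: "'a \<Rightarrow> real"
  assumes f: "f \<in> borel_measurable M" and Z: "integrable M Z" and le: "\<And>x. f x \<le> Z x"
  shows "ext_integral M f \<le> ereal (integral\<^sup>L M Z)"
proof -
  have "(\<integral>\<^sup>+ x. ennreal (f x) \<partial>M) \<le> (\<integral>\<^sup>+ x. ennreal (norm (Z x)) \<partial>M)"
    using le by (intro nn_integral_mono ennreal_leI) (simp add: abs_le_iff order_trans[OF le abs_ge_self])
  also have "\<dots> < \<infinity>" using Z by (simp add: integrable_iff_bounded)
  finally obtain a where a: "0 \<le> a" "(\<integral>\<^sup>+ x. ennreal (f x) \<partial>M) = ennreal a"
    by (cases "\<integral>\<^sup>+ x. ennreal (f x) \<partial>M") auto
  show ?thesis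
  proof (cases "(\<integral>\<^sup>+ x. ennreal (- f x) \<partial>M) = \<infinity>")
    case True
    then show ?thesis using a by (simp add: ext_integral_def)
  next
    case False
    then obtain b where b: "0 \<le> b" "(\<integral>\<^sup>+ x. ennreal (- f x) \<partial>M) = ennreal b"
      by (cases "\<integral>\<^sup>+ x. ennreal (- f x) \<partial>M") auto
    have int: "integrable M f" using f a b by (simp add: real_integrable_def)
    have "ext_integral M f = ereal (integral\<^sup>L M f)"
      using a b by (simp add: ext_integral_def real_lebesgue_integral_def[OF int])
    also have "\<dots> \<le> ereal (integral\<^sup>L M Z)" using integral_mono[OF int Z le] by simp
    finally show ?thesis .
  qed
qed

text \<open>This is \<open>ln z \<le> z - 1\<close> for \<open>z = v powr (r - p) / I\<close>. Integrated against a density with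
  \<open>G * v powr p\<close> of total mass \<open>1\<close> and \<open>I\<close> the integral of \<open>G * v powr r\<close>, it is Jensen's inequality
  for the logarithm.\<close>
lemma log_jensen_pointwise:
  fixes G v p r I :: real
  assumes "0 \<le> G" "0 \<le> v" "0 < p" "p < r" "0 < I"
  shows "G * (v powr p * ln (v powr p)) \<le> p / (r - p) * (G * v powr r / I + (ln I - 1) * (G * v powr p))"
proof (cases "v = 0")
  case False
  then have v: "0 < v" using assms by simp
  have "ln (v powr (r - p) / I) \<le> v powr (r - p) / I - 1" using v assms by (intro ln_le_minus_one) auto
  then have "(r - p) * ln v \<le> v powr (r - p) / I + (ln I - 1)" using v assms by (simp add: ln_div ln_powr)
  then have "G * v powr p * ((r - p) * ln v) \<le> G * v powr p * (v powr (r - p) / I + (ln I - 1))"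
    using assms by (intro mult_left_mono) auto
  also have "\<dots> = G * (v powr p * v powr (r - p)) / I + (ln I - 1) * (G * v powr p)" by (simp add: algebra_simps)
  also have "v powr p * v powr (r - p) = v powr r" by (simp add: powr_add[symmetric])
  finally have "p / (r - p) * (G * v powr p * ((r - p) * ln v)) \<le> p / (r - p) * (G * v powr r / I + (ln I - 1) * (G * v powr p))"
    using assms by (intro mult_left_mono) auto
  moreover have "p / (r - p) * (G * v powr p * ((r - p) * ln v)) = G * (v powr p * ln (v powr p))"
    using v assms by (simp add: ln_powr)
  ultimately show ?thesis by simp
qed simp

theorem theorem1p1:
  fixes g u :: "real ^ 'n \<Rightarrow> real" and p r :: real
  assumes "CARD('n) \<ge> 3"
    and "1 < p" and "p < real CARD('n)"
    and "p < r" and "r \<le> sobolev_exponent CARD('n) p"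
    and "g \<in> H_space p r"
    and "u \<in> beppo_levi p"
    and "(LINT x|lebesgue. \<bar>g x\<bar> * \<bar>u x\<bar> powr p) = 1"
  shows "ext_integral lebesgue (\<lambda>x. \<bar>g x\<bar> * (\<bar>u x\<bar> powr p * ln (\<bar>u x\<bar> powr p)))
    \<le> ereal (r / (r - p) * ln (C_H p * enn2real (H_norm p r g) powr (p / r) * dirichlet p u))"
proof -
  note p = \<open>1 < p\<close> \<open>p < real CARD('n)\<close> \<open>p < r\<close>
  have [measurable]: "g \<in> borel_measurable lebesgue" "u \<in> borel_measurable lebesgue"
    using assms(6,7) by (auto simp: H_space_def locally_integrable_def beppo_levi_def)
  define W where "W x = \<bar>g x\<bar> * \<bar>u x\<bar> powr p" for x
  define V where "V x = \<bar>g x\<bar> * \<bar>u x\<bar> powr r" for x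
  define H where "H = enn2real (H_norm p r g)"
  define D where "D = dirichlet p u"
  have H0: "0 \<le> H" and D0: "0 \<le> D" and C0: "0 \<le> C_H p"
    using dirichlet_nonneg by (auto simp: H_def D_def C_H_def)
  have intW: "(LINT x|lebesgue. W x) = 1" using assms(8) by (simp add: W_def)
  have W: "integrable lebesgue W"
    by (rule ccontr) (use intW not_integrable_integral_eq in force)
  have Vb: "(\<integral>\<^sup>+ x. ennreal (V x) \<partial>lebesgue) \<le> ennreal (H * (C_H p * D) powr (r / p))"
    using capacitary_inequality[OF assms(7) p assms(6)] by (simp add: V_def H_def D_def)
  have [measurable]: "V \<in> borel_measurable lebesgue" unfolding V_def by measurable
  have V0: "0 \<le> V x" for x by (simp add: V_def)
  have V: "integrable lebesgue V"
    using Vb by (intro integrableI_bounded) (auto simp: V_def intro: le_less_trans)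
  define I where "I = (LINT x|lebesgue. V x)"
  have "ennreal I \<le> ennreal (H * (C_H p * D) powr (r / p))"
    using nn_integral_eq_integral[OF V] V0 Vb by (simp add: I_def)
  then have I_le: "I \<le> H * (C_H p * D) powr (r / p)" using H0 by (simp add: ennreal_le_iff)
  \<comment> \<open>\<open>V\<close> and \<open>W\<close> have the same zeros, and \<open>W\<close> has integral \<open>1\<close>.\<close>
  have I_pos: "0 < I"
  proof (rule ccontr)
    assume "\<not> 0 < I"
    moreover have "0 \<le> I" unfolding I_def by (rule integral_nonneg_AE) (simp add: V_def)
    ultimately have "I = 0" by simp
    then have "AE x in lebesgue. V x = 0"
      using integral_nonneg_eq_0_iff_AE[OF V] V0 by (simp add: I_def)
    then have "AE x in lebesgue. W x = 0" by (rule AE_mp) (auto simp: V_def W_def)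
    then have "(LINT x|lebesgue. W x) = 0" by (rule integral_eq_zero_AE)
    with intW show False by simp
  qed
  define X where "X = C_H p * H powr (p / r) * D"
  \<comment> \<open>\<open>X\<close> is normalised so that the capacitary inequality reads \<open>I \<le> X powr (r / p)\<close>. Since \<open>I > 0\<close>,
    the argument of the final logarithm is positive.\<close>
  have X0: "0 \<le> X" using C0 D0 by (simp add: X_def)
  have "X powr (r / p) = (C_H p * D) powr (r / p) * (H powr (p / r)) powr (r / p)"
    using C0 D0 by (simp add: X_def powr_mult mult_ac)
  also have "(H powr (p / r)) powr (r / p) = H" using p H0 by (simp add: powr_powr)
  finally have IX: "I \<le> X powr (r / p)" using I_le by (simp add: mult.commute)
  then have X_pos: "0 < X" using I_pos X0 by (cases "X = 0") auto
  have "ln I \<le> ln (X powr (r / p))" using IX I_pos X_pos by (subst ln_le_cancel_iff) auto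
  then have lnI: "ln I \<le> r / p * ln X" using X_pos by (simp add: ln_powr)
  define Z where "Z x = p / (r - p) * (V x / I + (ln I - 1) * W x)" for x
  have Z: "integrable lebesgue Z" unfolding Z_def using V W by simp
  have "ext_integral lebesgue (\<lambda>x. \<bar>g x\<bar> * (\<bar>u x\<bar> powr p * ln (\<bar>u x\<bar> powr p))) \<le> ereal (LINT x|lebesgue. Z x)"
  proof (rule ext_integral_le_integral[OF _ Z])
    show "\<bar>g x\<bar> * (\<bar>u x\<bar> powr p * ln (\<bar>u x\<bar> powr p)) \<le> Z x" for x
      using log_jensen_pointwise[of "\<bar>g x\<bar>" "\<bar>u x\<bar>" p r I] p I_pos by (simp add: Z_def V_def W_def)
  qed measurable
  also have "(LINT x|lebesgue. Z x) = p / (r - p) * (I / I + (ln I - 1) * 1)"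
    unfolding Z_def using V W intW by (simp add: I_def)
  also have "\<dots> = p / (r - p) * ln I" using I_pos by simp
  also have "ereal (p / (r - p) * ln I) \<le> ereal (r / (r - p) * ln X)"
  proof -
    have "p / (r - p) * ln I \<le> p / (r - p) * (r / p * ln X)" using p lnI by (intro mult_left_mono) auto
    then show ?thesis using p by simp
  qed
  finally show ?thesis by (simp add: X_def H_def D_def)
qed

end
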